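(* Let $s, m \ge 1$ and $n_1, \dotsc, n_s \ge 1$ be integers. For $j = 1, \dotsc, s$, let $q_j \in \beta\mathcal{F}$ be an uncongested idempotent ultrafilter, and let $U_1, \dotsc, U_m$ be commuting unitary operators on a Hilbert space $\mathcal{H}$. Let $f_1, \dotsc, f_m \in \mathrm{Int}[\vec{z}_1, \dotsc, \vec{z}_s]$ be polynomials, where the variable $\vec{z}_j$ has dimension $n_j$, satisfying $f_i(0) = 0$ for all $i = 1, \dotsc, m$. Let in addition IP-sets $w_{\bullet}^{k,j} : \mathcal{F} \to \mathbb{N}$ be given, for $j = 1, \dotsc, s$ and $k = 1, \dotsc, n_j$. Define an operator $P$ on $\mathcal{H}$ by the (iterated) weak operator limit $$P = q_1\text{-}\lim_{\alpha_1} \cdots\, q_s\text{-}\lim_{\alpha_s}\ \prod_{i=1}^{m} U_i^{f_i\left(w_{\alpha_1}^{1,1}, \dotsc, w_{\alpha_1}^{n_1,1}, \dotsc, w_{\alpha_s}^{1,s}, \dotsc, w_{\alpha_s}^{n_s,s}\right)}.$$ Then $P$ is an orthogonal projection. Moreover, any two operators defined in this way (from the same $U_1, \dotsc, U_m$, but possibly different choices of the remaining data) commute.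
   Context: Here $\mathbb{N} = \{0,1,2,\dotsc\}$, and $\mathcal{F}$ is the set of all nonempty finite subsets of $\mathbb{N}$, a commutative semigroup under union $\cup$. An ultrafilter $p$ on a commutative semigroup $(S,\circ)$ is a collection of subsets of $S$ such that $S \in p$, $\emptyset \notin p$; $p$ is closed under supersets and finite intersections; and for every $A \subseteq S$ either $A \in p$ or $S \setminus A \in p$. The set of all ultrafilters on $S$ is $\beta S$. For $p, q \in \beta S$ the product $p \circ q \in \beta S$ is defined by: $A \in p \circ q$ if and only if $\{s \in S : \{t \in S : s \circ t \in A\} \in q\} \in p$. An ultrafilter $p$ is idempotent if $p \circ p = p$. For $n\in\mathbb{N}$ let $C_n = \{\alpha \in \mathcal{F} : n \in \alpha\}$; an ultrafilter $p \in \beta\mathcal{F}$ is uncongested if $C_n \notin p$ for every $n \in \mathbb{N}$. An IP-set is a map $n_\bullet : \mathcal{F} \to \mathbb{N}$, $\alpha \mapsto n_\alpha = \sum_{i \in \alpha} n_i$, where $(n_i)_{i \in \mathbb{N}}$ is a sequence of positive integers. For a map $f : S \to Y$ into a topological space, $y = p\text{-}\lim_s f(s)$ means that $f^{-1}(U) \in p$ for every neighborhood $U$ of $y$; when $Y$ is compact (Hausdorff) such limits exist and are unique. For a uniformly bounded family of operators $T_s$ on $\mathcal{H}$, the weak operator limit $T = p\text{-}\lim_s T_s$ is the operator with $\langle T x, y\rangle = p\text{-}\lim_s \langle T_s x, y\rangle$ for all $x, y \in \mathcal{H}$; iterated limits are taken successively from the innermost (rightmost) outwards. In the claim each $\alpha_j$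 ranges over $\mathcal{F}$. $\mathrm{Int}[\vec{z}_1, \dotsc, \vec{z}_s]$ denotes the additive group of polynomials with rational coefficients in all the coordinates of $\vec{z}_1, \dotsc, \vec{z}_s$ that take integer values at all integer arguments. *)

theory Defs
  imports "HOL-Analysis.Analysis" "HOL-Library.Poly_Mapping"
begin

section \<open>Complex Hilbert spaces and operators\<close>

text \<open>
  The inner product is linear in the first argument. The last axiom says at once that
  the form is positive definite and that the (complete) norm is the one it induces.
\<close>

class complex_hilbert = banach +
  fixes scaleC :: "complex \<Rightarrow> 'a \<Rightarrow> 'a"
    and cinner :: "'a \<Rightarrow> 'a \<Rightarrow> complex"
  assumes scaleC_add_right: "scaleC c (x + y) = scaleC c x + scaleC c y"
    and scaleC_add_left: "scaleC (c + d) x = scaleC c x + scaleC d x"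
    and scaleC_scaleC: "scaleC c (scaleC d x) = scaleC (c * d) x"
    and scaleR_scaleC: "scaleR r x = scaleC (complex_of_real r) x"
    and cinner_commute: "cinner x y = cnj (cinner y x)"
    and cinner_add_left: "cinner (x + y) z = cinner x z + cinner y z"
    and cinner_scaleC_left: "cinner (scaleC c x) y = c * cinner x y"
    and cinner_self: "cinner x x = complex_of_real ((norm x)\<^sup>2)"

instantiation complex :: complex_hilbert
begin

definition scaleC_complex :: "complex \<Rightarrow> complex \<Rightarrow> complex"
  where "scaleC_complex c x = c * x"

definition cinner_complex :: "complex \<Rightarrow> complex \<Rightarrow> complex"
  where "cinner_complex x y = x * cnj y"

instance
proof
  fix c d x y z :: complex and r :: real
  show "scaleC c (x + y) = scaleC c x + scaleC c y"
    unfolding scaleC_complex_def by (rule distrib_left)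
  show "scaleC (c + d) x = scaleC c x + scaleC d x"
    unfolding scaleC_complex_def by (rule distrib_right)
  show "scaleC c (scaleC d x) = scaleC (c * d) x"
    unfolding scaleC_complex_def by (rule mult.assoc[symmetric])
  show "scaleR r x = scaleC (complex_of_real r) x"
    unfolding scaleC_complex_def by (rule scaleR_conv_of_real)
  show "cinner x y = cnj (cinner y x)"
    unfolding cinner_complex_def by (simp add: mult.commute)
  show "cinner (x + y) z = cinner x z + cinner y z"
    unfolding cinner_complex_def by (rule distrib_right)
  show "cinner (scaleC c x) y = c * cinner x y"
    unfolding cinner_complex_def scaleC_complex_def by (rule mult.assoc)
  show "cinner x x = complex_of_real ((norm x)\<^sup>2)"
    unfolding cinner_complex_def by (rule complex_norm_square[symmetric])
qed

end

definition bounded_clinear :: "('h::complex_hilbert \<Rightarrow> 'h) \<Rightarrow> bool"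
  where "bounded_clinear T \<longleftrightarrow> bounded_linear T \<and> (\<forall>c x. T (scaleC c x) = scaleC c (T x))"

definition unitary_op :: "('h::complex_hilbert \<Rightarrow> 'h) \<Rightarrow> bool"
  where "unitary_op U \<longleftrightarrow>
    bounded_clinear U \<and> surj U \<and> (\<forall>x y. cinner (U x) (U y) = cinner x y)"

definition orthogonal_projection :: "('h::complex_hilbert \<Rightarrow> 'h) \<Rightarrow> bool"
  where "orthogonal_projection P \<longleftrightarrow>
    bounded_clinear P \<and> P \<circ> P = P \<and> (\<forall>x y. cinner (P x) y = cinner x (P y))"

definition op_powi :: "('a \<Rightarrow> 'a) \<Rightarrow> int \<Rightarrow> 'a \<Rightarrow> 'a"
  where "op_powi U k = (if 0 \<le> k then U ^^ nat k else inv U ^^ nat (- k))"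

definition op_prod :: "nat \<Rightarrow> (nat \<Rightarrow> 'a \<Rightarrow> 'a) \<Rightarrow> 'a \<Rightarrow> 'a"
  where "op_prod m T = foldr (\<circ>) (map T [1..<m + 1]) id"


section \<open>Ultrafilters\<close>

definition ultrafilter_on :: "'a set \<Rightarrow> 'a set set \<Rightarrow> bool"
  where "ultrafilter_on S p \<longleftrightarrow>
    p \<subseteq> Pow S \<and> S \<in> p \<and> {} \<notin> p \<and>
    (\<forall>A B. A \<in> p \<longrightarrow> A \<subseteq> B \<longrightarrow> B \<subseteq> S \<longrightarrow> B \<in> p) \<and>
    (\<forall>A B. A \<in> p \<longrightarrow> B \<in> p \<longrightarrow> A \<inter> B \<in> p) \<and>
    (\<forall>A. A \<subseteq> S \<longrightarrow> A \<in> p \<or> S - A \<in> p)"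

definition uf_prod :: "'a set \<Rightarrow> ('a \<Rightarrow> 'a \<Rightarrow> 'a) \<Rightarrow> 'a set set \<Rightarrow> 'a set set \<Rightarrow> 'a set set"
  where "uf_prod S f p q = {A. A \<subseteq> S \<and> {s \<in> S. {t \<in> S. f s t \<in> A} \<in> q} \<in> p}"

definition uf_idempotent :: "'a set \<Rightarrow> ('a \<Rightarrow> 'a \<Rightarrow> 'a) \<Rightarrow> 'a set set \<Rightarrow> bool"
  where "uf_idempotent S f p \<longleftrightarrow> uf_prod S f p p = p"

definition is_uf_lim ::
    "'a set \<Rightarrow> 'a set set \<Rightarrow> ('a \<Rightarrow> 'b::topological_space) \<Rightarrow> 'b \<Rightarrow> bool"
  where "is_uf_lim S p f y \<longleftrightarrow> (\<forall>V. open V \<longrightarrow> y \<in> V \<longrightarrow> {s \<in> S. f s \<in> V} \<in> p)"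

definition is_wot_lim ::
    "'a set \<Rightarrow> 'a set set \<Rightarrow> ('a \<Rightarrow> 'h \<Rightarrow> 'h) \<Rightarrow> ('h::complex_hilbert \<Rightarrow> 'h) \<Rightarrow> bool"
  where "is_wot_lim S p T L \<longleftrightarrow> bounded_clinear L \<and>
    (\<forall>x y. is_uf_lim S p (\<lambda>s. cinner (T s x) y) (cinner (L x) y))"

text \<open>
  Meaningful for uniformly bounded families, for which the limit exists; uniqueness
  is the lemma following the definition.
\<close>

definition wot_lim ::
    "'a set \<Rightarrow> 'a set set \<Rightarrow> ('a \<Rightarrow> 'h \<Rightarrow> 'h) \<Rightarrow> 'h::complex_hilbert \<Rightarrow> 'h"
  where "wot_lim S p T = (THE L. is_wot_lim S p T L)"

lemma is_uf_lim_unique: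
  fixes f :: "'a \<Rightarrow> 'b::t2_space"
  assumes p: "ultrafilter_on S p" and y: "is_uf_lim S p f y" and z: "is_uf_lim S p f z"
  shows "y = z"
proof (rule ccontr)
  have inter: "\<forall>A B. A \<in> p \<longrightarrow> B \<in> p \<longrightarrow> A \<inter> B \<in> p"
    using p unfolding ultrafilter_on_def by (elim conjE)
  have empty: "{} \<notin> p"
    using p unfolding ultrafilter_on_def by (elim conjE)
  assume "y \<noteq> z"
  then obtain V W where VW: "open V" "open W" "y \<in> V" "z \<in> W" "V \<inter> W = {}"
    using hausdorff[of y z] by blast
  have "{s \<in> S. f s \<in> V} \<in> p" "{s \<in> S. f s \<in> W} \<in> p"
    using y z VW(1-4) unfolding is_uf_lim_def by auto
  with inter have "{s \<in> S. f s \<in> V} \<inter> {s \<in> S. f s \<in> W} \<in> p"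
    by blast
  moreover have "{s \<in> S. f s \<in> V} \<inter> {s \<in> S. f s \<in> W} = {}"
    using VW(5) by blast
  ultimately show False
    using empty by simp
qed

lemma wot_lim_eq:
  fixes L :: "'h::complex_hilbert \<Rightarrow> 'h"
  assumes p: "ultrafilter_on S p" and L: "is_wot_lim S p T L"
  shows "wot_lim S p T = L"
  unfolding wot_lim_def
proof (rule the_equality)
  fix M assume M: "is_wot_lim S p T M"
  show "M = L"
  proof
    fix x
    define d where "d = M x - L x"
    have M_x: "M x = d + L x"
      by (simp add: d_def)
    have "is_uf_lim S p (\<lambda>s. cinner (T s x) d) (cinner (L x) d)"
      using L by (simp add: is_wot_lim_def)
    moreover have "is_uf_lim S p (\<lambda>s. cinner (T s x) d) (cinner (M x) d)"
      using M by (simp add: is_wot_lim_def)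
    ultimately have "cinner (M x) d = cinner (L x) d"
      by (rule is_uf_lim_unique[OF p, symmetric])
    then have "cinner d d = 0"
      unfolding M_x cinner_add_left by simp
    then have "d = 0"
      unfolding cinner_self by simp
    then show "M x = L x"
      by (simp add: M_x)
  qed
qed (fact L)


section \<open>Finite sets of natural numbers and IP-sets\<close>

definition FinN :: "nat set set"
  where "FinN = {\<alpha>. finite \<alpha> \<and> \<alpha> \<noteq> {}}"

definition uncongested :: "nat set set set \<Rightarrow> bool"
  where "uncongested p \<longleftrightarrow> (\<forall>n. {\<alpha> \<in> FinN. n \<in> \<alpha>} \<notin> p)"

definition ip_set :: "(nat set \<Rightarrow> nat) \<Rightarrow> bool"
  where "ip_set w \<longleftrightarrow>
    (\<exists>a :: nat \<Rightarrow> nat. (\<forall>i. 0 < a i) \<and> (\<forall>\<alpha> \<in> FinN. w \<alpha> = (\<Sum>i\<in>\<alpha>. a i)))"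


section \<open>Integer-valued rational polynomials\<close>

text \<open>
  A polynomial maps monomials (finitely supported exponent vectors) to coefficients.
\<close>

type_synonym 'v rat_mpoly = "('v \<Rightarrow>\<^sub>0 nat) \<Rightarrow>\<^sub>0 rat"

definition mpoly_vars :: "'v rat_mpoly \<Rightarrow> 'v set"
  where "mpoly_vars f = (\<Union>\<mu>\<in>Poly_Mapping.keys f. Poly_Mapping.keys \<mu>)"

definition mpoly_eval :: "'v rat_mpoly \<Rightarrow> ('v \<Rightarrow> rat) \<Rightarrow> rat"
  where "mpoly_eval f a = (\<Sum>\<mu>\<in>Poly_Mapping.keys f.
    Poly_Mapping.lookup f \<mu> * (\<Prod>v\<in>Poly_Mapping.keys \<mu>. a v ^ Poly_Mapping.lookup \<mu> v))"

definition Int_poly :: "'v set \<Rightarrow> 'v rat_mpoly set"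
  where "Int_poly X = {f. mpoly_vars f \<subseteq> X \<and>
    (\<forall>a :: 'v \<Rightarrow> int. mpoly_eval f (\<lambda>v. of_int (a v)) \<in> \<int>)}"

text \<open>The pair \<open>(k, j)\<close> is the \<open>k\<close>-th coordinate of the \<open>j\<close>-th vector variable.\<close>

definition coord_vars :: "nat \<Rightarrow> (nat \<Rightarrow> nat) \<Rightarrow> (nat \<times> nat) set"
  where "coord_vars s n = {(k, j). j \<in> {1..s} \<and> k \<in> {1..n j}}"


section \<open>The iterated limit operators\<close>

text \<open>
  \<open>iter_wot_lim s q G\<close> is the iterated limit of \<open>G\<close> along \<open>q 1\<close> (outermost) to \<open>q s\<close>
  (innermost). The argument of \<open>G\<close> sends \<open>j\<close> to \<open>\<alpha>\<^sub>j\<close>; its values outside \<open>{1..s}\<close>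
  are immaterial.
\<close>

primrec iter_wot_lim ::
    "nat \<Rightarrow> (nat \<Rightarrow> nat set set set) \<Rightarrow> ((nat \<Rightarrow> nat set) \<Rightarrow> 'h \<Rightarrow> 'h)
      \<Rightarrow> 'h::complex_hilbert \<Rightarrow> 'h"
  where
    "iter_wot_lim 0 q G = G (\<lambda>_. {})"
  | "iter_wot_lim (Suc s) q G =
      iter_wot_lim s q (\<lambda>\<alpha>. wot_lim FinN (q (Suc s)) (\<lambda>\<beta>. G (\<alpha>(Suc s := \<beta>))))"

text \<open>For \<open>f\<close> in \<open>Int_poly\<close> the value under the floor is an integer.\<close>

definition ip_exponent ::
    "(nat \<times> nat) rat_mpoly \<Rightarrow> (nat \<Rightarrow> nat \<Rightarrow> nat set \<Rightarrow> nat) \<Rightarrow> (nat \<Rightarrow> nat set) \<Rightarrow> int"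
  where "ip_exponent f w \<alpha> = \<lfloor>mpoly_eval f (\<lambda>(k, j). of_nat (w k j (\<alpha> j)))\<rfloor>"

definition ip_limit_operator ::
    "nat \<Rightarrow> (nat \<Rightarrow> 'h::complex_hilbert \<Rightarrow> 'h) \<Rightarrow> nat \<Rightarrow> (nat \<Rightarrow> nat set set set)
      \<Rightarrow> (nat \<Rightarrow> (nat \<times> nat) rat_mpoly) \<Rightarrow> (nat \<Rightarrow> nat \<Rightarrow> nat set \<Rightarrow> nat) \<Rightarrow> 'h \<Rightarrow> 'h"
  where "ip_limit_operator m U s q f w =
    iter_wot_lim s q (\<lambda>\<alpha>. op_prod m (\<lambda>i. op_powi (U i) (ip_exponent (f i) w \<alpha>)))"

text \<open>\<open>w k j\<close> is the IP-set \<open>w\<close> with upper index \<open>k,j\<close>.\<close>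

definition ip_limit_data ::
    "nat \<Rightarrow> nat \<Rightarrow> (nat \<Rightarrow> nat) \<Rightarrow> (nat \<Rightarrow> nat set set set)
      \<Rightarrow> (nat \<Rightarrow> (nat \<times> nat) rat_mpoly) \<Rightarrow> (nat \<Rightarrow> nat \<Rightarrow> nat set \<Rightarrow> nat) \<Rightarrow> bool"
  where "ip_limit_data m s n q f w \<longleftrightarrow>
    1 \<le> s \<and>
    (\<forall>j\<in>{1..s}. 1 \<le> n j) \<and>
    (\<forall>j\<in>{1..s}. ultrafilter_on FinN (q j) \<and> uncongested (q j) \<and> uf_idempotent FinN (\<union>) (q j)) \<and>
    (\<forall>i\<in>{1..m}. f i \<in> Int_poly (coord_vars s n) \<and> mpoly_eval (f i) (\<lambda>_. 0) = 0) \<and>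
    (\<forall>j\<in>{1..s}. \<forall>k\<in>{1..n j}. ip_set (w k j))"

end

theory Submission
  imports Defs "HOL-Library.Function_Algebras"
begin

text \<open>
  Let \<open>V e\<close> be the product of the \<open>U\<^sub>i\<close> raised to the powers \<open>e i\<close>, a unitary representation of a
  finitely generated free abelian group. The operators in question are weak limits of operators
  \<open>V e\<close>, so they commute with all \<open>V e\<close>; as soon as they are known to be self-adjoint, they commute with
  weak limits of the \<open>V e\<close>, hence with each other. Since they are contractions, it remains to show
  that they are idempotent.

  The key difficulty is that a weak limit of projections need not be a projection. It is one, however, for
  projections \<open>W g\<close> indexed by a group of polynomials of bounded degree with the property that the \<open>g\<close> with
  \<open>W g x = x\<close> form a subgroup for each vector \<open>x\<close>: such a group of integer-valued polynomials is finitely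
  generated, and the ascending chain condition allows one to choose a counterexample \<open>x\<close> with maximal subgroup
  (\<open>projection_if_fixed_groups_noetherian\<close>). The subgroup property holds for the limits of unitary operators
  considered here because a vector fixed by a weak limit of unitary operators is the norm
  limit of its images under them.

  For one vector variable, the proof is by induction on the degree (\<open>projection_one_variable\<close>). If
  \<open>g(a + b) = g(a) + g(b) + D\<^sub>a(b)\<close>, then \<open>D\<^sub>a\<close> has lower degree, so it yields a projection \<open>Q\<^sub>a\<close>, and these
  converge to a projection \<open>R\<close>. On the range of \<open>R\<close> the term \<open>D\<^sub>a(b)\<close> may be ignored and idempotence of
  the ultrafilter gives \<open>P = P \<circ> P\<close>, exactly as for linear exponents. On the kernel of \<open>R\<close> the van der Corput
  trick (\<open>van_der_corput\<close>) gives \<open>P = 0\<close>.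

  For several variables, one splits off the innermost limit (\<open>projection_iterated_limit\<close>). The part of
  the exponent that depends on the innermost variable gives projections, whose limit \<open>R\<close> over the other
  variables is a projection by the chain condition; the remaining part of the exponent has fewer variables
  and gives a projection \<open>A\<close> by induction. Then \<open>A\<close> and \<open>R\<close> commute and the whole limit is \<open>A \<circ> R\<close>.
\<close>


section \<open>Ascending chains of subgroups\<close>

definition additive_subgroup :: "'g::ab_group_add set \<Rightarrow> bool"
  where "additive_subgroup G \<longleftrightarrow> 0 \<in> G \<and> (\<forall>a\<in>G. \<forall>b\<in>G. a - b \<in> G)"

lemma additive_subgroupD:
  assumes "additive_subgroup G"
  shows "0 \<in> G" "a \<in> G \<Longrightarrow> b \<in> G \<Longrightarrow> a - b \<in> G"
    "a \<in> G \<Longrightarrow> - a \<in> G" "a \<in> G \<Longrightarrow> b \<in> G \<Longrightarrow> a + b \<in> G"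
proof -
  show z: "0 \<in> G" and d: "a \<in> G \<Longrightarrow> b \<in> G \<Longrightarrow> a - b \<in> G" for a b
    using assms by (auto simp: additive_subgroup_def)
  show m: "a \<in> G \<Longrightarrow> - a \<in> G" for a
    using d[of 0 a] z by simp
  show "a \<in> G \<Longrightarrow> b \<in> G \<Longrightarrow> a + b \<in> G"
    using d[of a "- b"] m by simp
qed

lemma int_subgroup_dvd:
  fixes G :: "int set"
  assumes G: "additive_subgroup G" and a: "int k \<in> G" "0 < k"
    and least: "\<And>j. 0 < j \<Longrightarrow> int j \<in> G \<Longrightarrow> k \<le> j" and x: "x \<in> G"
  shows "int k dvd x"
proof -
  have mult: "int j * int k \<in> G" for j
    by (induction j) (auto simp: algebra_simps intro: additive_subgroupD[OF G] a)
  have "z * int k \<in> G" for z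
  proof (cases "0 \<le> z")
    case True
    then show ?thesis using mult[of "nat z"] by simp
  next
    case False
    then show ?thesis using additive_subgroupD(3)[OF G mult[of "nat (- z)"]] by simp
  qed
  then have "x - x div int k * int k \<in> G"
    by (rule additive_subgroupD(2)[OF G x])
  then have "int (nat (x mod int k)) \<in> G"
    using a(2) by (simp add: minus_div_mult_eq_mod)
  moreover have "nat (x mod int k) < k"
    using a(2) by (simp add: nat_less_iff)
  ultimately have "nat (x mod int k) = 0"
    using least by (meson not_less neq0_conv)
  moreover have "0 \<le> x mod int k"
    using a(2) by simp
  ultimately show ?thesis
    by (simp add: dvd_eq_mod_eq_0)
qed

lemma int_subgroup_multiple:
  fixes G :: "int set"
  assumes G: "additive_subgroup G" and a: "a \<in> G" and dvd: "a dvd x"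
  shows "x \<in> G"
proof -
  obtain z where z: "x = a * z" using dvd by (auto simp: dvd_def)
  have mult: "a * int j \<in> G" for j
    by (induction j) (auto simp: algebra_simps intro: additive_subgroupD[OF G] a)
  show ?thesis
  proof (cases "0 \<le> z")
    case True
    then show ?thesis using mult[of "nat z"] z by simp
  next
    case False
    then show ?thesis using additive_subgroupD(3)[OF G mult[of "nat (- z)"]] z by simp
  qed
qed

text \<open>
  A nonzero subgroup of the integers is determined by its least positive element, which strictly
  decreases when the subgroup grows; the zero subgroup has to be ranked apart.
\<close>

lemma wf_int_subgroups:
  "wf {(G', G :: int set). additive_subgroup G \<and> additive_subgroup G' \<and> G \<subset> G'}"
proof -
  define least where "least G = (LEAST k. 0 < k \<and> int k \<in> G)" for G :: "int set"
  have pos: "\<exists>k>0. int k \<in> G" if G: "additive_subgroup G" "G \<noteq> {0}" for G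
  proof -
    obtain x where x: "x \<in> G" "x \<noteq> 0"
      using G additive_subgroupD(1)[OF G(1)] by blast
    show ?thesis
    proof (cases "0 < x")
      case True
      then show ?thesis using x by (intro exI[of _ "nat x"]) auto
    next
      case False
      then show ?thesis using x additive_subgroupD(3)[OF G(1) x(1)]
        by (intro exI[of _ "nat (- x)"]) auto
    qed
  qed
  have least: "0 < least G" "int (least G) \<in> G" if "additive_subgroup G" "G \<noteq> {0}" for G
    using LeastI_ex[OF pos[OF that]] by (auto simp: least_def)
  have least_le: "least G \<le> k" if "0 < k" "int k \<in> G" for G k
    unfolding least_def using that by (intro Least_le) simp
  have "{(G', G :: int set). additive_subgroup G \<and> additive_subgroup G' \<and> G \<subset> G'}
    \<subseteq> inv_image (less_than <*lex*> less_than) (\<lambda>G. (if G = {0} then 1 else 0, least G))"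
  proof (rule subrelI)
    fix G' G :: "int set"
    assume "(G', G) \<in> {(G', G :: int set). additive_subgroup G \<and> additive_subgroup G' \<and> G \<subset> G'}"
    then have G: "additive_subgroup G" and G': "additive_subgroup G'" and sub: "G \<subset> G'"
      by auto
    have "G' \<noteq> {0}"
      using sub additive_subgroupD(1)[OF G] by auto
    note l' = least[OF G' this]
    have "least G' < least G" if "G \<noteq> {0}"
    proof (rule ccontr)
      assume "\<not> ?thesis"
      moreover note l = least[OF G that]
      moreover have "least G' \<le> least G"
        using l sub by (intro least_le) auto
      ultimately have eq: "least G' = least G" by simp
      have "G' \<subseteq> G"
      proof
        fix x assume "x \<in> G'"
        then have "int (least G) dvd x"
          using int_subgroup_dvd[OF G' l'(2,1) least_le] eq by auto
        then show "x \<in> G"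
          by (rule int_subgroup_multiple[OF G l(2)])
      qed
      then show False using sub by blast
    qed
    then show "(G', G) \<in> inv_image (less_than <*lex*> less_than)
        (\<lambda>G. (if G = {0} then 1 else 0, least G))"
      using \<open>G' \<noteq> {0}\<close> by auto
  qed
  then show ?thesis
    by (rule wf_subset[rotated]) (intro wf_inv_image wf_lex_prod wf_less_than)
qed

text \<open>
  The ascending chain condition for subgroups of a group on which finitely many characters with
  values in the integers are given. Two subgroups with the same image under a character \<open>e\<close> and the
  same intersection with its kernel agree if one contains the other, so the rank of a subgroup can be
  taken to be the pair of its image (a subgroup of the integers) and its intersection with the kernel
  of \<open>e\<close>, where one character fewer remains. The side condition relating \<open>G'\<close> to \<open>G\<close> says that the
  larger subgroup gains nothing on the common kernel of the characters, which the characters cannot see.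
\<close>

lemma wf_subgroups:
  fixes E :: "('g::ab_group_add \<Rightarrow> int) set"
  assumes "finite E" and add: "\<And>e a b. e \<in> E \<Longrightarrow> e (a - b) = e a - e b"
  shows "wf {(G', G). additive_subgroup G \<and> additive_subgroup G' \<and> G \<subset> G' \<and>
    {a \<in> G'. \<forall>e\<in>E. e a = 0} \<subseteq> G}"
  using assms
proof (induction E rule: finite_induct)
  case empty
  show ?case
    by (rule wf_subset[OF wf_on_bot]) blast
next
  case (insert e E)
  let ?R = "\<lambda>E. {(G', G). additive_subgroup G \<and> additive_subgroup G' \<and> G \<subset> G' \<and>
    {a \<in> G'. \<forall>e\<in>E. e a = 0} \<subseteq> G}"
  let ?Z = "{(G', G :: int set). additive_subgroup G \<and> additive_subgroup G' \<and> G \<subset> G'}"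
  let ?f = "\<lambda>G. (e ` G, {a \<in> G. e a = 0})"
  have e: "e (a - b) = e a - e b" for a b
    using insert.prems by blast
  have e0: "e 0 = 0" using e[of 0 0] by simp
  have image: "additive_subgroup (e ` G)" and kernel: "additive_subgroup {a \<in> G. e a = 0}"
    if G: "additive_subgroup G" for G
  proof -
    have "e a - e b \<in> e ` G" if "a \<in> G" "b \<in> G" for a b
      using additive_subgroupD(2)[OF G that] e by (metis imageI)
    then show "additive_subgroup (e ` G)"
      using additive_subgroupD(1)[OF G] e0 by (force simp: additive_subgroup_def)
    show "additive_subgroup {a \<in> G. e a = 0}"
      using additive_subgroupD(1,2)[OF G] e0 e by (simp add: additive_subgroup_def)
  qed
  have "?R (insert e E) \<subseteq> inv_image (?Z <*lex*> ?R E) ?f"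
  proof (rule subrelI)
    fix G' G
    assume "(G', G) \<in> ?R (insert e E)"
    then have G: "additive_subgroup G" and G': "additive_subgroup G'" and sub: "G \<subset> G'"
      and ker: "{a \<in> G'. \<forall>e\<in>insert e E. e a = 0} \<subseteq> G"
      by auto
    have "{a \<in> G. e a = 0} \<noteq> {a \<in> G'. e a = 0}" if img: "e ` G = e ` G'"
    proof
      assume eq: "{a \<in> G. e a = 0} = {a \<in> G'. e a = 0}"
      have "G' \<subseteq> G"
      proof
        fix x assume x: "x \<in> G'"
        then obtain y where y: "y \<in> G" "e y = e x"
          using img by (metis imageE imageI)
        then have "x - y \<in> {a \<in> G'. e a = 0}"
          using sub e additive_subgroupD(2)[OF G' x] by auto
        then have "x - y \<in> G" using eq by blast
        then show "x \<in> G" using additive_subgroupD(4)[OF G _ y(1)] by fastforce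
      qed
      then show False using sub by blast
    qed
    moreover have "e ` G \<subseteq> e ` G'" "{a \<in> G. e a = 0} \<subseteq> {a \<in> G'. e a = 0}"
      using sub by auto
    ultimately show "(G', G) \<in> inv_image (?Z <*lex*> ?R E) ?f"
      using image[OF G] image[OF G'] kernel[OF G] kernel[OF G'] ker by (simp add: psubset_eq) blast
  qed
  moreover have "wf (?R E)"
    using insert by blast
  ultimately show ?case
    using wf_int_subgroups by (blast intro: wf_subset wf_inv_image wf_lex_prod)
qed


section \<open>Polynomial maps by vanishing differences\<close>

text \<open>
  Polynomial maps between abelian groups in the sense of Frechet: \<open>frechet d g\<close> says that \<open>d\<close>-fold
  differences of \<open>g\<close> vanish, so the degree of \<open>g\<close> is less than \<open>d\<close>, and \<open>d = 0\<close> leaves only the zero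
  map. This notion replaces coefficients altogether: it applies directly to integer-valued polynomials
  with rational coefficients, is stable under translation, and differences lower the degree by one.
\<close>

primrec frechet :: "nat \<Rightarrow> ('a::ab_group_add \<Rightarrow> 'b::ab_group_add) \<Rightarrow> bool"
  where
    "frechet 0 g \<longleftrightarrow> (\<forall>x. g x = 0)"
  | "frechet (Suc d) g \<longleftrightarrow> (\<forall>a. frechet d (\<lambda>x. g (a + x) - g x))"

lemma frechet_zero: "frechet d (\<lambda>x. 0)"
  by (induction d) simp_all

lemma frechet_Suc: "frechet d g \<Longrightarrow> frechet (Suc d) g"
proof (induction d arbitrary: g)
  case (Suc d)
  have "frechet (Suc d) (\<lambda>x. g (a + x) - g x)" for a
    using Suc.prems by (intro Suc.IH) simp
  then show ?case
    by (subst frechet.simps) blast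
qed simp

lemma frechet_mono: "frechet c g \<Longrightarrow> c \<le> d \<Longrightarrow> frechet d g"
proof (induction d)
  case (Suc d)
  then show ?case
    by (cases "c = Suc d") (auto simp del: frechet.simps intro: frechet_Suc)
qed simp

lemma frechet_shift: "frechet d g \<Longrightarrow> frechet d (\<lambda>x. g (a + x))"
proof (induction d arbitrary: g)
  case (Suc d)
  show ?case
    unfolding frechet.simps
  proof
    fix b
    have "frechet d (\<lambda>x. g (b + x) - g x)"
      using Suc.prems by simp
    from Suc.IH[OF this] show "frechet d (\<lambda>x. g (a + (b + x)) - g (a + x))"
      by (simp add: add.left_commute)
  qed
qed simp

lemma frechet_diff: "frechet d g \<Longrightarrow> frechet d h \<Longrightarrow> frechet d (\<lambda>x. g x - h x)"
proof (induction d arbitrary: g h)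
  case (Suc d)
  show ?case
    unfolding frechet.simps
  proof
    fix a
    have "frechet d (\<lambda>x. (g (a + x) - g x) - (h (a + x) - h x))"
      using Suc by simp
    then show "frechet d (\<lambda>x. g (a + x) - h (a + x) - (g x - h x))"
      by (simp add: algebra_simps)
  qed
qed simp

lemma frechet_add: "frechet d g \<Longrightarrow> frechet d h \<Longrightarrow> frechet d (\<lambda>x. g x + h x)"
  using frechet_diff[of d g "\<lambda>x. 0 - h x"] frechet_diff[OF frechet_zero, of d h] by simp

lemma frechet_const: "frechet (Suc 0) (\<lambda>x. c)"
  by simp

lemma frechet_shift_pointed:
  assumes g: "frechet d g"
  shows "frechet d (\<lambda>x. g (a + x) - g a)"
proof (cases d)
  case 0
  then show ?thesis using g by simp
next
  case (Suc e)
  have "frechet d (\<lambda>x. g a)"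
    by (rule frechet_mono[OF frechet_const]) (simp add: Suc)
  then show ?thesis by (rule frechet_diff[OF frechet_shift[OF g]])
qed

text \<open>
  The polarized difference of \<open>g\<close> vanishes at \<open>0\<close> and still has lower degree than \<open>g\<close>. Subtracting the
  constant \<open>g a\<close> could raise the degree only if \<open>g\<close> were constant, and then \<open>g 0 = 0\<close> makes it zero.
\<close>

lemma frechet_derivative_pointed:
  assumes g: "frechet (Suc d) g" "g 0 = 0"
  shows "frechet d (\<lambda>x. g (a + x) - g x - g a)"
proof (cases d)
  case 0
  then have "g (a + x) - g x = 0" for x using g by simp
  moreover from this[of 0] have "g a = 0" using g by simp
  ultimately show ?thesis using 0 by simp
next
  case (Suc e)
  have "frechet d (\<lambda>x. g (a + x) - g x)" using g(1) by simp
  moreover have "frechet d (\<lambda>x. g a)"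
    by (rule frechet_mono[OF frechet_const]) (simp add: Suc)
  ultimately show ?thesis by (rule frechet_diff)
qed

text \<open>
  The Leibniz rule \<open>\<Delta>(g h)(x) = \<Delta>g(x) h(a + x) + g(x) \<Delta>h(x)\<close> reduces the sum of the two degrees.
\<close>

lemma frechet_mult:
  fixes g h :: "'a::ab_group_add \<Rightarrow> 'b::comm_ring"
  assumes "frechet c g" "frechet d h"
  shows "frechet (c + d) (\<lambda>x. g x * h x)"
  using assms
proof (induction "c + d" arbitrary: c d g h)
  case 0
  then show ?case by simp
next
  case (Suc n)
  consider "c = 0" | "d = 0" | c' d' where "c = Suc c'" "d = Suc d'"
    by (metis not0_implies_Suc)
  then show ?case
  proof cases
    case 1
    then have "(\<lambda>x. g x * h x) = (\<lambda>x. 0)" using Suc.prems by simp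
    then show ?thesis using frechet_zero by metis
  next
    case 2
    then have "(\<lambda>x. g x * h x) = (\<lambda>x. 0)" using Suc.prems by simp
    then show ?thesis using frechet_zero by metis
  next
    case 3
    have "frechet (c' + d) (\<lambda>x. (g (a + x) - g x) * h (a + x))" for a
      using Suc.prems 3 by (intro Suc.hyps(1) frechet_shift) (use Suc.hyps(2) in auto)
    moreover have "frechet (c + d') (\<lambda>x. g x * (h (a + x) - h x))" for a
      using Suc.prems 3 by (intro Suc.hyps(1)) (use Suc.hyps(2) in auto)
    ultimately have "frechet (c + d') (\<lambda>x. (g (a + x) - g x) * h (a + x) + g x * (h (a + x) - h x))" for a
      by (intro frechet_add) (use 3 in simp_all)
    moreover have "(g (a + x) - g x) * h (a + x) + g x * (h (a + x) - h x)
        = g (a + x) * h (a + x) - g x * h x" for a x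
      by (simp add: algebra_simps)
    ultimately have "frechet (Suc (c + d')) (\<lambda>x. g x * h x)"
      by simp
    then show ?thesis
      unfolding 3 by (simp only: add_Suc_right)
  qed
qed

lemma frechet_of_int:
  fixes g :: "'a::ab_group_add \<Rightarrow> int"
  assumes "frechet d (\<lambda>x. of_int (g x) :: 'r::{comm_ring_1,ring_char_0})"
  shows "frechet d g"
  using assms
proof (induction d arbitrary: g)
  case (Suc d)
  show ?case
    unfolding frechet.simps
  proof
    fix a
    show "frechet d (\<lambda>x. g (a + x) - g x)"
      using Suc.prems by (intro Suc.IH) simp
  qed
qed simp

lemma frechet_additive_comp:
  assumes "frechet d g" and add: "\<And>a b. \<kappa> (a - b) = \<kappa> a - \<kappa> b"
  shows "frechet d (\<lambda>x. \<kappa> (g x))"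
  using assms(1)
proof (induction d arbitrary: g)
  case 0
  have "\<kappa> 0 = 0" using add[of 0 0] by simp
  with 0 show ?case by simp
next
  case (Suc d)
  then show ?case by (simp add: add[symmetric])
qed

lemma frechet_components:
  fixes g :: "'a::ab_group_add \<Rightarrow> 'i \<Rightarrow> 'b::ab_group_add"
  assumes "\<And>i. frechet d (\<lambda>x. g x i)"
  shows "frechet d g"
  using assms
proof (induction d arbitrary: g)
  case 0
  then show ?case by (simp add: fun_eq_iff)
next
  case (Suc d)
  show ?case
    unfolding frechet.simps
  proof
    fix a
    show "frechet d (\<lambda>x. g (a + x) - g x)"
      using Suc.prems by (intro Suc.IH) simp
  qed
qed

lemma frechet_mpoly_eval:
  fixes f :: "'v rat_mpoly"
  shows "\<exists>d. frechet d (\<lambda>x :: 'v \<Rightarrow> int. mpoly_eval f (\<lambda>v. of_int (x v)))"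
proof -
  let ?poly = "\<lambda>h :: ('v \<Rightarrow> int) \<Rightarrow> rat. \<exists>d. frechet d h"
  have const: "?poly (\<lambda>x. c)" for c
    using frechet_const by blast
  have add: "?poly (\<lambda>x. g x + h x)" if gh: "?poly g" "?poly h" for g h
  proof -
    obtain c d where "frechet c g" "frechet d h" using gh by blast
    then have "frechet (max c d) (\<lambda>x. g x + h x)"
      by (intro frechet_add) (auto intro: frechet_mono)
    then show ?thesis by blast
  qed
  have mult: "?poly (\<lambda>x. g x * h x)" if "?poly g" "?poly h" for g h
    using that frechet_mult by blast
  have coord: "?poly (\<lambda>x. of_int (x v))" for v
    by (intro exI[of _ "Suc (Suc 0)"]) simp
  have power: "?poly (\<lambda>x. of_int (x v) ^ k)" for v k
    by (induction k) (simp_all add: const mult coord del: frechet.simps)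
  have prod: "?poly (\<lambda>x. \<Prod>v\<in>A. of_int (x v) ^ e v)" if "finite A" for A e
    using that by induction (simp_all add: const mult power del: frechet.simps)
  have sum: "?poly (\<lambda>x. \<Sum>\<mu>\<in>M. c \<mu> * (\<Prod>v\<in>Poly_Mapping.keys \<mu>. of_int (x v) ^ e \<mu> v))"
    if "finite M" for M :: "('v \<Rightarrow>\<^sub>0 nat) set" and c :: "('v \<Rightarrow>\<^sub>0 nat) \<Rightarrow> rat" and e
    using that by induction
      (simp_all add: const add mult prod del: frechet.simps)
  show ?thesis
    unfolding mpoly_eval_def by (intro sum) simp
qed

text \<open>
  Evaluations at finitely many points separate the polynomial maps of bounded degree in finitely many
  integer variables. They supply the characters for the ascending chain condition without any basis of
  the space of polynomials.
  For the step, the points are those that work for the differences, their translates by unit vectors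
  and the unit vectors. If \<open>g\<close> vanishes there, then all its differences in unit directions are
  zero, so \<open>g\<close> is periodic in every direction and hence constant.
\<close>

lemma frechet_determined_by_finitely_many_points:
  assumes X: "finite X"
  shows "\<exists>S. finite S \<and> (\<forall>g :: ('v \<Rightarrow> int) \<Rightarrow> 'b::ab_group_add.
    frechet d g \<longrightarrow> g 0 = 0 \<longrightarrow> (\<forall>x\<in>S. g x = 0) \<longrightarrow>
    (\<forall>x. (\<forall>v. v \<notin> X \<longrightarrow> x v = 0) \<longrightarrow> g x = 0))"
proof (induction d)
  case 0
  then show ?case by auto
next
  case (Suc d)
  then obtain S where S: "finite S" and "\<forall>g :: ('v \<Rightarrow> int) \<Rightarrow> 'b. frechet d g \<longrightarrow> g 0 = 0 \<longrightarrow>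
      (\<forall>x\<in>S. g x = 0) \<longrightarrow> (\<forall>x. (\<forall>v. v \<notin> X \<longrightarrow> x v = 0) \<longrightarrow> g x = 0)"
    by (elim exE conjE)
  note det = this(2)[rule_format]
  define e where "e k z = (\<lambda>v. if v = k then z else 0 :: int)" for k :: 'v and z
  have e_add: "e k (z + z') = e k z + e k z'" and e_0: "e k 0 = 0" for k z z'
    by (auto simp: e_def fun_eq_iff)
  let ?S = "S \<union> (\<Union>k\<in>X. insert (e k 1) ((+) (e k 1) ` S))"
  have main: "g x = 0" if g: "frechet (Suc d) g" "g 0 = 0" and gS: "\<And>x. x \<in> ?S \<Longrightarrow> g x = 0"
    and x: "\<And>v. v \<notin> X \<Longrightarrow> x v = 0" for g :: "('v \<Rightarrow> int) \<Rightarrow> 'b" and x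
  proof -
    have step: "g (e k 1 + x) = g x" if "k \<in> X" "\<And>v. v \<notin> X \<Longrightarrow> x v = 0" for k x
    proof -
      have "g (e k 1 + x) - g x = 0"
      proof (rule det[where g = "\<lambda>x. g (e k 1 + x) - g x"])
        show "frechet d (\<lambda>x. g (e k 1 + x) - g x)" using g by simp
        show "g (e k 1 + 0) - g 0 = 0" using gS[of "e k 1"] g that by auto
        show "g (e k 1 + y) - g y = 0" if "y \<in> S" for y
          using gS[of y] gS[of "e k 1 + y"] that \<open>k \<in> X\<close> by auto
      qed (rule that)
      then show ?thesis by simp
    qed
    have steps: "g (e k z + x) = g x" if k: "k \<in> X" and x: "\<And>v. v \<notin> X \<Longrightarrow> x v = 0" for k z x
    proof (induction z rule: int_induct[of _ 0])
      case base
      then show ?case by (simp add: e_0)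
    next
      case (step1 i)
      have "g (e k 1 + (e k i + x)) = g (e k i + x)"
        using k x by (intro step) (auto simp: e_def)
      moreover have "e k 1 + (e k i + x) = e k (1 + i) + x"
        by (simp only: e_add add.assoc)
      ultimately show ?case using step1(2) by (simp only: add.commute[of i 1])
    next
      case (step2 i)
      have "g (e k 1 + (e k (i - 1) + x)) = g (e k (i - 1) + x)"
        using k x by (intro step) (auto simp: e_def)
      moreover have "e k 1 + (e k (i - 1) + x) = e k i + x"
        using e_add[of k 1 "i - 1"] by (simp add: add.assoc)
      ultimately show ?case using step2(2) by metis
    qed
    have "g x = 0" if "finite Y" "Y \<subseteq> X" "\<And>v. v \<notin> Y \<Longrightarrow> x v = 0" for Y x
      using that
    proof (induction Y arbitrary: x rule: finite_induct)
      case empty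
      then have "x = 0" by (auto simp: fun_eq_iff)
      then show ?case using g(2) by (simp only:)
    next
      case (insert k Y)
      have "g (x(k := 0)) = 0"
        using insert.prems by (intro insert.IH) auto
      moreover have "x = e k (x k) + x(k := 0)"
        by (auto simp: e_def fun_eq_iff)
      moreover have "g (e k (x k) + x(k := 0)) = g (x(k := 0))"
        using insert.prems by (intro steps) auto
      ultimately show ?case by simp
    qed
    from this[OF X order_refl x] show ?thesis .
  qed
  show ?case
  proof (intro exI conjI allI impI)
    show "finite ?S" using S X by auto
    show "g x = 0" if "frechet (Suc d) g" "g 0 = 0" "\<forall>x\<in>?S. g x = 0" "\<forall>v. v \<notin> X \<longrightarrow> x v = 0"
      for g :: "('v \<Rightarrow> int) \<Rightarrow> 'b" and x
      by (rule main[OF that(1,2)]) (use that(3,4) in \<open>auto simp only:\<close>)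
  qed
qed


section \<open>Hilbert spaces and projections\<close>

lemma cinner_diff_left: "cinner (x - y) z = cinner x z - cinner y z"
  using cinner_add_left[of "x - y" y z] by (simp add: eq_diff_eq)

lemma cinner_add_right: "cinner x (y + z) = cinner x y + cinner x z"
  by (metis cinner_add_left cinner_commute complex_cnj_add)

lemma cinner_diff_right: "cinner x (y - z) = cinner x y - cinner x z"
  using cinner_add_right[of x "y - z" z] by (simp add: eq_diff_eq)

lemma cinner_zero_left [simp]: "cinner 0 x = 0"
  using cinner_diff_left[of 0 0 x] by simp

lemma cinner_zero_right [simp]: "cinner x 0 = 0"
  using cinner_diff_right[of x 0 0] by simp

lemma cinner_scaleC_right: "cinner x (scaleC c y) = cnj c * cinner x y"
  by (metis cinner_commute cinner_scaleC_left complex_cnj_mult)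

lemma cinner_scaleR_right: "cinner x (r *\<^sub>R y) = of_real r * cinner x y"
  by (simp add: scaleR_scaleC cinner_scaleC_right)

lemma norm_eq_Re_cinner: "(norm x)\<^sup>2 = Re (cinner x x)"
  by (simp add: cinner_self)

lemma Re_cinner_commute: "Re (cinner x y) = Re (cinner y x)"
  by (subst cinner_commute) simp

lemma norm_add_sq: "(norm (x + y))\<^sup>2 = (norm x)\<^sup>2 + 2 * Re (cinner x y) + (norm y)\<^sup>2"
  using Re_cinner_commute[of x y]
  by (simp add: norm_eq_Re_cinner cinner_add_left cinner_add_right)

lemma norm_diff_sq: "(norm (x - y))\<^sup>2 = (norm x)\<^sup>2 - 2 * Re (cinner x y) + (norm y)\<^sup>2"
  using Re_cinner_commute[of x y]
  by (simp add: norm_eq_Re_cinner cinner_diff_left cinner_diff_right)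

lemma cauchy_schwarz: "norm (cinner x y) \<le> norm x * norm y"
proof (cases "y = 0")
  case False
  define c where "c = cinner x y / of_real ((norm y)\<^sup>2)"
  have ny: "(norm y)\<^sup>2 > 0" using False by simp
  have "cinner x (scaleC c y) = of_real ((cmod (cinner x y))\<^sup>2 / (norm y)\<^sup>2)"
    unfolding cinner_scaleC_right c_def
    by (simp only: of_real_divide complex_norm_square complex_cnj_divide complex_cnj_complex_of_real
        times_divide_eq_left mult.commute[of "cnj _"])
  then have 1: "Re (cinner x (scaleC c y)) = (cmod (cinner x y))\<^sup>2 / (norm y)\<^sup>2"
    by simp
  have "cinner (scaleC c y) (scaleC c y) = of_real ((cmod c)\<^sup>2 * (norm y)\<^sup>2)"
    unfolding cinner_scaleC_right cinner_scaleC_left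
    by (simp only: cinner_self of_real_mult complex_norm_square mult_ac)
  then have 2: "(norm (scaleC c y))\<^sup>2 = (cmod c)\<^sup>2 * (norm y)\<^sup>2"
    by (simp only: norm_eq_Re_cinner Re_complex_of_real)
  have c: "(cmod c)\<^sup>2 * (norm y)\<^sup>2 = (cmod (cinner x y))\<^sup>2 / (norm y)\<^sup>2"
  proof -
    have "cmod c = cmod (cinner x y) / (norm y)\<^sup>2"
      unfolding c_def norm_divide norm_of_real by simp
    then show ?thesis
      using ny by (simp add: power_divide power2_eq_square)
  qed
  have "0 \<le> (norm (x - scaleC c y))\<^sup>2" by simp
  then have "(cmod (cinner x y))\<^sup>2 / (norm y)\<^sup>2 \<le> (norm x)\<^sup>2"
    unfolding norm_diff_sq 1 2 c by simp
  then have "(cmod (cinner x y))\<^sup>2 \<le> (norm x * norm y)\<^sup>2"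
    using ny by (simp add: field_simps power_mult_distrib)
  then show ?thesis
    by (rule power2_le_imp_le) simp
qed simp

lemma cinner_ext: "(\<And>y. cinner a y = cinner b y) \<Longrightarrow> a = b"
proof -
  assume "\<And>y. cinner a y = cinner b y"
  then have "cinner (a - b) (a - b) = 0" by (simp add: cinner_diff_left)
  then show ?thesis by (simp add: cinner_self)
qed

lemma complex_eq_by_Re:
  assumes "Re a = Re b" "Re (\<i> * a) = Re (\<i> * b)"
  shows "a = b"
  using assms by (simp add: complex_eq_iff)

text \<open>
  The first-order condition at a minimum: for small \<open>t\<close> the linear term dominates the quadratic one.
\<close>

lemma linear_term_vanishes:
  fixes b N :: real
  assumes "\<And>t. 0 \<le> 2 * t * b + t\<^sup>2 * N"
  shows "b = 0"
proof (rule ccontr)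
  assume b: "b \<noteq> 0"
  define c where "c = \<bar>N\<bar> + 1"
  have c: "c > 0" by (simp add: c_def)
  have "0 \<le> 2 * (- b / c) * b + (- b / c)\<^sup>2 * N" by (rule assms)
  then have "0 \<le> (2 * (- b / c) * b + (- b / c)\<^sup>2 * N) * c\<^sup>2"
    by simp
  also have "\<dots> = b\<^sup>2 * (N - 2 * c)"
    using c by (simp add: field_simps power2_eq_square)
  also have "\<dots> < 0"
    using b by (intro mult_pos_neg) (auto simp: c_def)
  finally show False by simp
qed

text \<open>
  The Riesz representation theorem. The representing vector is the minimizer of
  \<open>J x = (norm x)\<^sup>2 - 2 Re (h x)\<close>, because the derivative of \<open>J\<close> at \<open>z\<close> in direction \<open>x\<close> is
  \<open>2 Re (cinner x z - h x)\<close>.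
\<close>

lemma riesz:
  fixes h :: "'h::complex_hilbert \<Rightarrow> complex"
  assumes add: "\<And>x y. h (x + y) = h x + h y" and scale: "\<And>c x. h (scaleC c x) = c * h x"
    and bound: "\<And>x. norm (h x) \<le> K * norm x"
  shows "\<exists>z. \<forall>x. h x = cinner x z"
proof -
  define J where "J x = (norm x)\<^sup>2 - 2 * Re (h x)" for x
  have h_scaleR: "h (r *\<^sub>R x) = of_real r * h x" for r x
    by (simp add: scaleR_scaleC scale)
  have h_diff: "h (x - y) = h x - h y" for x y
    using add[of "x - y" y] by simp
  have Re_h: "Re (h x) \<le> K * norm x" for x
    using bound[of x] complex_Re_le_cmod[of "h x"] by linarith
  have lower: "- K\<^sup>2 \<le> J x" for x
  proof -
    have "0 \<le> (norm x - K)\<^sup>2" by simp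
    also have "\<dots> = (norm x)\<^sup>2 - 2 * (K * norm x) + K\<^sup>2" by (simp add: power2_diff)
    finally show ?thesis unfolding J_def using Re_h[of x] by linarith
  qed
  define I where "I = (INF x. J x)"
  have bdd: "bdd_below (range J)" using lower by (intro bdd_belowI2)
  have I_le: "I \<le> J x" for x unfolding I_def by (rule cINF_lower[OF bdd]) simp
  have near: "\<exists>x. J x < I + e" if "e > 0" for e
    using cINF_less_iff[OF _ bdd, of "I + e"] that unfolding I_def by auto
  \<comment> \<open>By the parallelogram law, two almost minimal points are close to each other.\<close>
  have convex: "(norm (x - y))\<^sup>2 \<le> 2 * (J x - I) + 2 * (J y - I)" for x y
  proof -
    define w where "w = (1/2) *\<^sub>R (x + y)"
    have "4 * J w = (norm (x + y))\<^sup>2 - 4 * Re (h (x + y))"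
      unfolding J_def w_def h_scaleR by (simp add: power_mult_distrib power_divide)
    also have "\<dots> = 2 * J x + 2 * J y - (norm (x - y))\<^sup>2"
      unfolding J_def add norm_add_sq norm_diff_sq by simp
    finally have "(norm (x - y))\<^sup>2 = 2 * J x + 2 * J y - 4 * J w" by simp
    then show ?thesis using I_le[of w] by (simp add: right_diff_distrib)
  qed
  obtain X where X: "\<And>n. J (X n) < I + 1 / real (Suc n)"
  proof -
    have "\<forall>n. \<exists>x. J x < I + 1 / real (Suc n)"
      by (intro allI near) simp
    then show ?thesis using that by metis
  qed
  have JX: "(\<lambda>n. J (X n)) \<longlonglongrightarrow> I"
  proof (rule tendsto_sandwich)
    show "(\<lambda>n. I) \<longlonglongrightarrow> I" by simp
    have "(\<lambda>n. I + 1 / real (Suc n)) \<longlonglongrightarrow> I + 0"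
      by (intro tendsto_add tendsto_const LIMSEQ_Suc lim_1_over_n)
    then show "(\<lambda>n. I + 1 / real (Suc n)) \<longlonglongrightarrow> I" by simp
    show "\<forall>\<^sub>F n in sequentially. I \<le> J (X n)"
      by (intro always_eventually allI I_le)
    show "\<forall>\<^sub>F n in sequentially. J (X n) \<le> I + 1 / real (Suc n)"
      by (intro always_eventually allI less_imp_le X)
  qed
  have "Cauchy X"
  proof (rule metric_CauchyI)
    fix e :: real assume e: "0 < e"
    then have "eventually (\<lambda>n. J (X n) < I + e\<^sup>2 / 4) sequentially"
      using JX by (intro order_tendstoD) auto
    then obtain M where M: "\<And>n. n \<ge> M \<Longrightarrow> J (X n) < I + e\<^sup>2 / 4"
      by (auto simp: eventually_sequentially)
    have "dist (X m) (X n) < e" if "m \<ge> M" "n \<ge> M" for m n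
    proof -
      have "(norm (X m - X n))\<^sup>2 < e\<^sup>2"
        using convex[of "X m" "X n"] M[OF that(1)] M[OF that(2)] by argo
      then show ?thesis
        unfolding dist_norm by (rule power2_less_imp_less) (use e in simp)
    qed
    then show "\<exists>M. \<forall>m\<ge>M. \<forall>n\<ge>M. dist (X m) (X n) < e" by blast
  qed
  then obtain z where z: "X \<longlonglongrightarrow> z"
    using Cauchy_convergent_iff convergent_def by blast
  have "bounded_linear h"
    by (rule bounded_linear_intro[where K = K])
      (use add h_scaleR bound in \<open>auto simp: scaleR_conv_of_real mult.commute\<close>)
  then have "(\<lambda>n. h (X n)) \<longlonglongrightarrow> h z"
    by (rule bounded_linear.tendsto[OF _ z])
  then have "(\<lambda>n. J (X n)) \<longlonglongrightarrow> J z"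
    unfolding J_def by (intro tendsto_intros z)
  then have Jz: "J z = I"
    using JX LIMSEQ_unique by blast
  have re: "Re (h x) = Re (cinner x z)" for x
  proof -
    define b where "b = Re (cinner x z) - Re (h x)"
    have "0 \<le> 2 * t * b + t\<^sup>2 * (norm x)\<^sup>2" for t
    proof -
      have "J (z + t *\<^sub>R x) = J z + (2 * t * b + t\<^sup>2 * (norm x)\<^sup>2)"
        unfolding J_def add h_scaleR norm_add_sq cinner_scaleR_right b_def
        by (simp add: power_mult_distrib algebra_simps Re_cinner_commute[of z x])
      then show ?thesis using I_le[of "z + t *\<^sub>R x"] Jz by linarith
    qed
    then have "b = 0" by (rule linear_term_vanishes)
    then show ?thesis by (simp add: b_def)
  qed
  have "h x = cinner x z" for x
    using re[of x] re[of "scaleC \<i> x"]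
    by (intro complex_eq_by_Re) (simp_all only: scale cinner_scaleC_left)
  then show ?thesis by blast
qed

definition contraction :: "('h::complex_hilbert \<Rightarrow> 'h) \<Rightarrow> bool"
  where "contraction T \<longleftrightarrow> bounded_clinear T \<and> (\<forall>x. norm (T x) \<le> norm x)"

lemma bounded_clinearD:
  assumes "bounded_clinear T"
  shows "T (x + y) = T x + T y" "T (x - y) = T x - T y" "T (scaleC c x) = scaleC c (T x)"
    "T 0 = 0" "T (r *\<^sub>R x) = r *\<^sub>R T x"
proof -
  have T: "bounded_linear T" "\<And>c x. T (scaleC c x) = scaleC c (T x)"
    using assms by (auto simp: bounded_clinear_def)
  interpret bounded_linear T by (rule T)
  show "T (x + y) = T x + T y" "T (x - y) = T x - T y" "T (scaleC c x) = scaleC c (T x)"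
    "T 0 = 0" "T (r *\<^sub>R x) = r *\<^sub>R T x"
    by (rule add diff T zero scaleR)+
qed

lemma bounded_clinear_comp:
  "bounded_clinear S \<Longrightarrow> bounded_clinear T \<Longrightarrow> bounded_clinear (S \<circ> T)"
  using bounded_linear_compose[of S T] by (simp add: bounded_clinear_def comp_def)

lemma contraction_comp: "contraction S \<Longrightarrow> contraction T \<Longrightarrow> contraction (S \<circ> T)"
  unfolding contraction_def by (metis bounded_clinear_comp comp_apply order_trans)

lemma contractionI:
  assumes "\<And>x y. T (x + y) = T x + T y" "\<And>c x. T (scaleC c x) = scaleC c (T x)"
    "\<And>x. norm (T x) \<le> norm x"
  shows "contraction T"
proof -
  have "bounded_linear T"
    by (rule bounded_linear_intro[where K = 1]) (simp_all add: assms scaleR_scaleC)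
  then show ?thesis
    using assms by (simp add: contraction_def bounded_clinear_def)
qed

lemma orthogonal_projectionD:
  assumes "orthogonal_projection P"
  shows "bounded_clinear P" "P (P x) = P x" "cinner (P x) y = cinner x (P y)"
    "(norm (P x))\<^sup>2 = Re (cinner (P x) x)" "norm (P x) \<le> norm x" "contraction P"
proof -
  show P: "bounded_clinear P" "P (P x) = P x" "cinner (P x) y = cinner x (P y)" for x y
    using assms unfolding orthogonal_projection_def by (auto dest: fun_cong[where x = x])
  show n: "(norm (P x))\<^sup>2 = Re (cinner (P x) x)" for x
    unfolding norm_eq_Re_cinner P(3)[of x "P x"] P(2) by (rule Re_cinner_commute)
  show norm: "norm (P x) \<le> norm x" for x
  proof -
    have "norm (P x) * norm (P x) \<le> norm (P x) * norm x"
      using n[of x] complex_Re_le_cmod[of "cinner (P x) x"] cauchy_schwarz[of "P x" x]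
      by (simp add: power2_eq_square)
    then show ?thesis
      by (cases "P x = 0") auto
  qed
  show "contraction P" unfolding contraction_def using P norm by auto
qed

text \<open>
  The range and the kernel of an idempotent contraction are orthogonal: otherwise moving a vector of
  the range slightly along the kernel would shorten it, while the contraction maps the shorter vector
  back to the longer one.
\<close>

lemma idempotent_contraction_projection:
  assumes P: "contraction P" and idem: "P \<circ> P = P"
  shows "orthogonal_projection P"
proof -
  have lin: "bounded_clinear P" and le: "norm (P x) \<le> norm x" for x
    using P by (auto simp: contraction_def)
  have PP: "P (P x) = P x" for x using idem by (auto simp: fun_eq_iff)
  have Re0: "Re (cinner u w) = 0" if u: "P u = u" and w: "P w = 0" for u w
  proof (rule linear_term_vanishes)
    fix t
    have "P (u + t *\<^sub>R w) = u"
      using u w by (simp add: bounded_clinearD[OF lin])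
    then have "norm u \<le> norm (u + t *\<^sub>R w)" using le[of "u + t *\<^sub>R w"] by simp
    then have "(norm u)\<^sup>2 \<le> (norm (u + t *\<^sub>R w))\<^sup>2" by (intro power_mono) auto
    then show "0 \<le> 2 * t * Re (cinner u w) + t\<^sup>2 * (norm w)\<^sup>2"
      unfolding norm_add_sq cinner_scaleR_right
      by (simp add: power_mult_distrib)
  qed
  have orth: "cinner u w = 0" if u: "P u = u" and w: "P w = 0" for u w
  proof (rule complex_eq_by_Re)
    show "Re (cinner u w) = Re 0" using Re0[OF that] by simp
    have "P (scaleC \<i> u) = scaleC \<i> u" using u by (simp add: bounded_clinearD[OF lin])
    from Re0[OF this w] show "Re (\<i> * cinner u w) = Re (\<i> * 0)"
      by (simp add: cinner_scaleC_left)
  qed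
  have ker: "P (x - P x) = 0" for x by (simp add: bounded_clinearD[OF lin] PP)
  have "cinner (P x) y = cinner x (P y)" for x y
  proof -
    have "cinner (P x) (y - P y) = 0" by (rule orth[OF PP ker])
    moreover have "cinner (x - P x) (P y) = 0"
      using orth[OF PP ker, of y x] cinner_commute[of "x - P x" "P y"] by simp
    ultimately show ?thesis by (simp add: cinner_diff_left cinner_diff_right)
  qed
  then show ?thesis unfolding orthogonal_projection_def using lin idem by blast
qed

lemma projection_id: "orthogonal_projection id"
  by (simp add: orthogonal_projection_def bounded_clinear_def bounded_linear_ident[folded id_def])

lemma projection_comp:
  assumes P: "orthogonal_projection P" and Q: "orthogonal_projection Q" and comm: "P \<circ> Q = Q \<circ> P"
  shows "orthogonal_projection (P \<circ> Q)"
proof (rule idempotent_contraction_projection)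
  show "contraction (P \<circ> Q)"
    by (intro contraction_comp orthogonal_projectionD(6) P Q)
  have "P (Q (P (Q x))) = P (Q x)" for x
    using comm orthogonal_projectionD(2)[OF P] orthogonal_projectionD(2)[OF Q]
    by (metis comp_apply)
  then show "P \<circ> Q \<circ> (P \<circ> Q) = P \<circ> Q" by auto
qed


section \<open>Weak operator limits along filters\<close>

text \<open>
  Limits are taken along filters rather than along collections of sets, so that iterated limits become
  limits along a single filter and the library of limits applies.
\<close>

definition wot_tendsto ::
    "('a \<Rightarrow> 'h \<Rightarrow> 'h) \<Rightarrow> ('h::complex_hilbert \<Rightarrow> 'h) \<Rightarrow> 'a filter \<Rightarrow> bool"
  where "wot_tendsto T L F \<longleftrightarrow> bounded_clinear L \<and>
    (\<forall>x y. ((\<lambda>a. cinner (T a x) y) \<longlongrightarrow> cinner (L x) y) F)"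

lemma wot_tendstoD: "wot_tendsto T L F \<Longrightarrow> ((\<lambda>a. cinner (T a x) y) \<longlongrightarrow> cinner (L x) y) F"
  by (simp add: wot_tendsto_def)

lemma wot_tendsto_unique:
  assumes "F \<noteq> bot" "wot_tendsto T L F" "wot_tendsto T M F"
  shows "L = M"
proof
  fix x
  show "L x = M x"
    using tendsto_unique[OF assms(1) wot_tendstoD[OF assms(2)] wot_tendstoD[OF assms(3)]]
    by (rule cinner_ext)
qed

lemma norm_le_if_weak_limit:
  assumes F: "F \<noteq> bot" and lim: "\<And>y. ((\<lambda>a. cinner (f a) y) \<longlongrightarrow> cinner z y) F"
    and bound: "\<And>a. norm (f a) \<le> K"
  shows "norm z \<le> K"
proof -
  have "norm (cinner z z) \<le> K * norm z"
  proof (rule tendsto_upperbound[OF tendsto_norm[OF lim] _ F])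
    have "norm (cinner (f a) z) \<le> K * norm z" for a
      using cauchy_schwarz[of "f a" z] mult_right_mono[OF bound[of a], of "norm z"] by simp
    then show "\<forall>\<^sub>F a in F. norm (cinner (f a) z) \<le> K * norm z" by simp
  qed
  then have "norm z * norm z \<le> K * norm z"
    unfolding cinner_self norm_of_real by (simp add: power2_eq_square)
  moreover obtain a where "norm (f a) \<le> K" using bound by blast
  then have "0 \<le> K" using norm_ge_zero[of "f a"] by linarith
  ultimately show ?thesis by (cases "z = 0") auto
qed

lemma wot_tendsto_contraction:
  assumes "F \<noteq> bot" "wot_tendsto T L F" "\<And>a. contraction (T a)"
  shows "contraction L"
  using norm_le_if_weak_limit[OF assms(1) wot_tendstoD[OF assms(2)]] assms(2,3)
  by (auto simp: contraction_def wot_tendsto_def)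

lemma wot_tendsto_commute:
  assumes F: "F \<noteq> bot" and T: "wot_tendsto T L F"
    and adj: "\<And>x y. cinner (B x) y = cinner x (C y)"
    and comm: "\<And>a x. T a (B x) = B (T a x)"
  shows "L \<circ> B = B \<circ> L"
proof
  fix x
  have "cinner (L (B x)) y = cinner (B (L x)) y" for y
  proof (rule tendsto_unique[OF F])
    show "((\<lambda>a. cinner (T a (B x)) y) \<longlongrightarrow> cinner (L (B x)) y) F"
      by (rule wot_tendstoD[OF T])
    show "((\<lambda>a. cinner (T a (B x)) y) \<longlongrightarrow> cinner (B (L x)) y) F"
      unfolding comm adj by (rule wot_tendstoD[OF T])
  qed
  then show "(L \<circ> B) x = (B \<circ> L) x"
    unfolding comp_apply by (rule cinner_ext)
qed

lemma wot_tendsto_self_adjoint: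
  assumes F: "F \<noteq> bot" and T: "wot_tendsto T L F"
    and adj: "\<And>a x y. cinner (T a x) y = cinner x (T a y)"
  shows "cinner (L x) y = cinner x (L y)"
proof (rule tendsto_unique[OF F])
  show "((\<lambda>a. cinner (T a x) y) \<longlongrightarrow> cinner (L x) y) F"
    by (rule wot_tendstoD[OF T])
  have "((\<lambda>a. cnj (cinner (T a y) x)) \<longlongrightarrow> cnj (cinner (L y) x)) F"
    by (intro tendsto_cnj wot_tendstoD[OF T])
  then show "((\<lambda>a. cinner (T a x) y) \<longlongrightarrow> cinner x (L y)) F"
    by (simp only: cinner_commute[symmetric] adj[symmetric])
qed

definition ultra :: "'a filter \<Rightarrow> bool"
  where "ultra F \<longleftrightarrow> F \<noteq> bot \<and> (\<forall>P. eventually P F \<or> eventually (\<lambda>x. \<not> P x) F)"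

lemma ultra_not_bot: "ultra F \<Longrightarrow> F \<noteq> bot"
  by (simp add: ultra_def)

lemma ultra_limit_exists:
  fixes f :: "'a \<Rightarrow> complex"
  assumes F: "ultra F" and bound: "\<And>a. norm (f a) \<le> K"
  shows "\<exists>l. (f \<longlongrightarrow> l) F"
proof -
  have "compact (cball (0::complex) K)" by simp
  moreover have "filtermap f F \<noteq> bot"
    using F by (simp add: ultra_def filtermap_bot_iff)
  moreover have "eventually (\<lambda>z. z \<in> cball 0 K) (filtermap f F)"
    using bound by (simp add: eventually_filtermap)
  ultimately obtain l where l: "inf (nhds l) (filtermap f F) \<noteq> bot"
    unfolding compact_filter by blast
  have "eventually (\<lambda>a. f a \<in> V) F" if V: "open V" "l \<in> V" for V
  proof (rule ccontr)
    assume "\<not> ?thesis"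
    then have "eventually (\<lambda>a. f a \<notin> V) F" using F by (auto simp: ultra_def)
    then have "eventually (\<lambda>z. z \<notin> V) (filtermap f F)" by (simp add: eventually_filtermap)
    moreover have "eventually (\<lambda>z. z \<in> V) (nhds l)"
      using V by (simp add: eventually_nhds_in_open)
    ultimately have "eventually (\<lambda>z. False) (inf (nhds l) (filtermap f F))"
      unfolding eventually_inf by blast
    with l show False by (simp add: trivial_limit_def)
  qed
  then have "(f \<longlongrightarrow> l) F" by (intro topological_tendstoI)
  then show ?thesis ..
qed

text \<open>
  The ball of bounded operators is compact in the weak operator topology: the numbers
  \<open>cinner (T a x) y\<close> stay in a compact disc, their limits form a bounded sesquilinear form, and the Riesz
  representation theorem turns this form into an operator.
\<close>

lemma wot_limit_exists:
  fixes T :: "'a \<Rightarrow> 'h::complex_hilbert \<Rightarrow> 'h"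
  assumes F: "ultra F" and T: "\<And>a. contraction (T a)"
  shows "\<exists>L. wot_tendsto T L F"
proof -
  note bot = ultra_not_bot[OF F]
  have le: "norm (T a x) \<le> norm x" and lin: "bounded_clinear (T a)" for a x
    using T[of a] by (auto simp: contraction_def)
  have bound: "norm (cinner (T a x) y) \<le> norm x * norm y" for a x y
    using cauchy_schwarz[of "T a x" y] mult_right_mono[OF le[of a x], of "norm y"] by simp
  then have "\<exists>l. ((\<lambda>a. cinner (T a x) y) \<longlongrightarrow> l) F" for x y
    by (intro ultra_limit_exists[OF F])
  then obtain l where l: "\<And>x y. ((\<lambda>a. cinner (T a x) y) \<longlongrightarrow> l x y) F"
    by metis
  have "\<exists>z. \<forall>y. cnj (l x y) = cinner y z" for x
  proof (rule riesz)
    show "cnj (l x (y + z)) = cnj (l x y) + cnj (l x z)" for y z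
    proof -
      have "l x (y + z) = l x y + l x z"
        by (rule tendsto_unique[OF bot l])
          (simp only: cinner_add_right, intro tendsto_add l)
      then show ?thesis by simp
    qed
    show "cnj (l x (scaleC c y)) = c * cnj (l x y)" for c y
    proof -
      have "l x (scaleC c y) = cnj c * l x y"
        by (rule tendsto_unique[OF bot l])
          (simp only: cinner_scaleC_right, intro tendsto_mult tendsto_const l)
      then show ?thesis by simp
    qed
    show "norm (cnj (l x y)) \<le> norm x * norm y" for y
      unfolding complex_mod_cnj
    proof (rule tendsto_upperbound[OF tendsto_norm[OF l] _ bot])
      show "\<forall>\<^sub>F a in F. norm (cinner (T a x) y) \<le> norm x * norm y"
        by (intro always_eventually allI bound)
    qed
  qed
  then obtain L where "\<And>x y. cnj (l x y) = cinner y (L x)" by metis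
  then have L: "l x y = cinner (L x) y" for x y
    by (metis cinner_commute complex_cnj_cnj)
  note lim = l[unfolded L]
  have "contraction L"
  proof (rule contractionI)
    show "L (x + y) = L x + L y" for x y
    proof (rule cinner_ext, rule tendsto_unique[OF bot lim])
      show "((\<lambda>a. cinner (T a (x + y)) z) \<longlongrightarrow> cinner (L x + L y) z) F" for z
        unfolding bounded_clinearD[OF lin] cinner_add_left by (intro tendsto_add lim)
    qed
    show "L (scaleC c x) = scaleC c (L x)" for c x
    proof (rule cinner_ext, rule tendsto_unique[OF bot lim])
      show "((\<lambda>a. cinner (T a (scaleC c x)) z) \<longlongrightarrow> cinner (scaleC c (L x)) z) F" for z
        unfolding bounded_clinearD[OF lin] cinner_scaleC_left
        by (intro tendsto_mult tendsto_const lim)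
    qed
    show "norm (L x) \<le> norm x" for x
      by (rule norm_le_if_weak_limit[OF bot lim le])
  qed
  then have "wot_tendsto T L F"
    using lim by (auto simp: wot_tendsto_def contraction_def)
  then show ?thesis by (intro exI[of _ L])
qed

text \<open>
  The filter of the iterated quantifier "for most \<open>a\<close> in \<open>F\<close>, for most \<open>x\<close> in \<open>K a\<close>".
  For ultrafilters \<open>p\<close>, \<open>q\<close> on a semigroup, the product \<open>p \<circ> q\<close> has this form with \<open>K a\<close> the translate of
  \<open>q\<close> by \<open>a\<close>.
\<close>

definition bind_filter :: "'a filter \<Rightarrow> ('a \<Rightarrow> 'b filter) \<Rightarrow> 'b filter"
  where "bind_filter F K = Abs_filter (\<lambda>P. eventually (\<lambda>a. eventually P (K a)) F)"

lemma eventually_bind_filter: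
  "eventually P (bind_filter F K) \<longleftrightarrow> eventually (\<lambda>a. eventually P (K a)) F"
  unfolding bind_filter_def
proof (rule eventually_Abs_filter, rule is_filter.intro)
  show "eventually (\<lambda>a. eventually (\<lambda>x. True) (K a)) F" by simp
  show "eventually (\<lambda>a. eventually (\<lambda>x. P x \<and> Q x) (K a)) F"
    if "eventually (\<lambda>a. eventually P (K a)) F" "eventually (\<lambda>a. eventually Q (K a)) F" for P Q
    using that by eventually_elim (rule eventually_conj)
  show "eventually (\<lambda>a. eventually Q (K a)) F"
    if "\<forall>x. P x \<longrightarrow> Q x" "eventually (\<lambda>a. eventually P (K a)) F" for P Q
    using that(2) by eventually_elim (use that(1) in \<open>auto elim: eventually_mono\<close>)
qed

lemma bind_filter_not_bot:
  assumes "F \<noteq> bot" "\<And>a. K a \<noteq> bot"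
  shows "bind_filter F K \<noteq> bot"
  using assms by (simp add: trivial_limit_def eventually_bind_filter)

lemma tendsto_bind_filter:
  fixes f :: "'b \<Rightarrow> 'c::metric_space"
  assumes inner: "eventually (\<lambda>a. (f \<longlongrightarrow> h a) (K a)) F" and outer: "(h \<longlongrightarrow> l) F"
  shows "(f \<longlongrightarrow> l) (bind_filter F K)"
proof (rule tendstoI)
  fix e :: real assume "e > 0"
  then have "eventually (\<lambda>a. dist (h a) l < e / 2) F"
    by (intro tendstoD[OF outer]) simp
  with inner have "eventually (\<lambda>a. eventually (\<lambda>x. dist (f x) l < e) (K a)) F"
  proof eventually_elim
    case (elim a)
    have "eventually (\<lambda>x. dist (f x) (h a) < e / 2) (K a)"
      using \<open>e > 0\<close> by (intro tendstoD[OF elim(1)]) simp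
    then show ?case
    proof eventually_elim
      case (elim x)
      then show ?case
        using dist_triangle[of "f x" l "h a"] \<open>dist (h a) l < e / 2\<close> by simp
    qed
  qed
  then show "eventually (\<lambda>x. dist (f x) l < e) (bind_filter F K)"
    by (simp add: eventually_bind_filter)
qed

definition pair_filter :: "'a filter \<Rightarrow> 'b filter \<Rightarrow> ('a \<times> 'b) filter"
  where "pair_filter F H = bind_filter F (\<lambda>a. filtermap (Pair a) H)"

lemma eventually_pair_filter:
  "eventually P (pair_filter F H) \<longleftrightarrow> (\<forall>\<^sub>F a in F. \<forall>\<^sub>F b in H. P (a, b))"
  by (simp add: pair_filter_def eventually_bind_filter eventually_filtermap)

lemma tendsto_pair_filter:
  fixes l :: "'c::metric_space"
  assumes "\<And>a. ((\<lambda>b. f a b) \<longlongrightarrow> h a) H" "(h \<longlongrightarrow> l) F"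
  shows "((\<lambda>(a, b). f a b) \<longlongrightarrow> l) (pair_filter F H)"
  unfolding pair_filter_def
  by (rule tendsto_bind_filter[OF _ assms(2)]) (simp add: filterlim_filtermap assms(1))

text \<open>
  Along an idempotent ultrafilter, a single variable may be replaced by the union of two successive
  ones, and the limit may be computed in the pair of variables.
\<close>

lemma tendsto_idempotent_filter:
  assumes idem: "bind_filter F (\<lambda>\<alpha>. filtermap (sup \<alpha>) F) = F"
    and lim: "((\<lambda>(\<alpha>, \<beta>). f (sup \<alpha> \<beta>)) \<longlongrightarrow> l) (pair_filter F F)"
  shows "(f \<longlongrightarrow> l) F"
proof (rule topological_tendstoI)
  fix S assume "open S" "l \<in> S"
  then have "\<forall>\<^sub>F p in pair_filter F F. (\<lambda>(\<alpha>, \<beta>). f (sup \<alpha> \<beta>)) p \<in> S"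
    by (rule topological_tendstoD[OF lim])
  then show "\<forall>\<^sub>F \<alpha> in F. f \<alpha> \<in> S"
    by (subst idem[symmetric])
      (simp add: eventually_pair_filter eventually_bind_filter eventually_filtermap)
qed

lemma wot_tendsto_bind_filter:
  assumes "\<And>a. wot_tendsto T (L a) (K a)" "wot_tendsto L M F"
  shows "wot_tendsto T M (bind_filter F K)"
  using assms unfolding wot_tendsto_def by (auto intro!: tendsto_bind_filter[where h = "\<lambda>a. cinner (L a _) _"])

definition uf_filter :: "'a set \<Rightarrow> 'a set set \<Rightarrow> 'a filter"
  where "uf_filter S p = Abs_filter (\<lambda>P. {s \<in> S. P s} \<in> p)"

lemma eventually_uf_filter:
  assumes p: "ultrafilter_on S p"
  shows "eventually P (uf_filter S p) \<longleftrightarrow> {s \<in> S. P s} \<in> p"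
  unfolding uf_filter_def
proof (rule eventually_Abs_filter, rule is_filter.intro)
  have "S \<in> p" and up: "\<And>A B. A \<in> p \<Longrightarrow> A \<subseteq> B \<Longrightarrow> B \<subseteq> S \<Longrightarrow> B \<in> p"
    and int: "\<And>A B. A \<in> p \<Longrightarrow> B \<in> p \<Longrightarrow> A \<inter> B \<in> p"
    using p unfolding ultrafilter_on_def by blast+
  then show "{s \<in> S. True} \<in> p" by simp
  show "{s \<in> S. P s \<and> Q s} \<in> p" if "{s \<in> S. P s} \<in> p" "{s \<in> S. Q s} \<in> p" for P Q
  proof -
    have "{s \<in> S. P s \<and> Q s} = {s \<in> S. P s} \<inter> {s \<in> S. Q s}" by blast
    then show ?thesis using int that by simp
  qed
  show "{s \<in> S. Q s} \<in> p" if "\<forall>x. P x \<longrightarrow> Q x" "{s \<in> S. P s} \<in> p" for P Q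
    using that by (intro up[OF that(2)]) auto
qed

lemma ultra_uf_filter:
  assumes p: "ultrafilter_on S p"
  shows "ultra (uf_filter S p)"
  unfolding ultra_def trivial_limit_def
proof (intro conjI allI)
  have "{} \<notin> p" and split: "\<And>A. A \<subseteq> S \<Longrightarrow> A \<in> p \<or> S - A \<in> p"
    using p unfolding ultrafilter_on_def by blast+
  then show "\<not> eventually (\<lambda>x. False) (uf_filter S p)"
    by (simp add: eventually_uf_filter[OF p])
  show "eventually P (uf_filter S p) \<or> eventually (\<lambda>x. \<not> P x) (uf_filter S p)" for P
  proof -
    have "S - {s \<in> S. P s} = {s \<in> S. \<not> P s}" by blast
    then show ?thesis
      using split[of "{s \<in> S. P s}"] by (simp add: eventually_uf_filter[OF p])
  qed
qed

lemma uf_filter_not_bot: "ultrafilter_on S p \<Longrightarrow> uf_filter S p \<noteq> bot"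
  by (rule ultra_not_bot[OF ultra_uf_filter])

lemma wot_lim_uf_filter:
  assumes p: "ultrafilter_on S p" and T: "wot_tendsto T L (uf_filter S p)"
  shows "wot_lim S p T = L"
proof (rule wot_lim_eq[OF p])
  show "is_wot_lim S p T L"
    using T by (auto simp: wot_tendsto_def is_wot_lim_def is_uf_lim_def tendsto_def
        eventually_uf_filter[OF p])
qed


section \<open>Weak limits of projections and the van der Corput trick\<close>

text \<open>
  For projections, weak convergence to a projection is strong convergence, since
  \<open>(norm (T x))\<^sup>2 = cinner (T x) x\<close> is itself a quantity controlled by weak convergence.
\<close>

lemma projections_strong_limit:
  assumes T: "wot_tendsto T R F" and proj: "\<And>a. orthogonal_projection (T a)"
    and R: "orthogonal_projection R"
  shows "((\<lambda>a. norm (T a x - R x)) \<longlongrightarrow> 0) F"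
proof -
  have "(norm (T a x - R x))\<^sup>2 = Re (cinner (T a x) x) - 2 * Re (cinner (T a x) (R x)) + Re (cinner (R x) x)" for a
    unfolding norm_diff_sq orthogonal_projectionD(4)[OF proj] orthogonal_projectionD(4)[OF R] ..
  moreover have "((\<lambda>a. Re (cinner (T a x) x) - 2 * Re (cinner (T a x) (R x)) + Re (cinner (R x) x))
      \<longlongrightarrow> Re (cinner (R x) x) - 2 * Re (cinner (R x) (R x)) + Re (cinner (R x) x)) F"
    by (intro tendsto_intros tendsto_Re wot_tendstoD[OF T])
  moreover have "Re (cinner (R x) (R x)) = Re (cinner (R x) x)"
    using orthogonal_projectionD(4)[OF R, of x] by (simp add: norm_eq_Re_cinner)
  ultimately have "((\<lambda>a. (norm (T a x - R x))\<^sup>2) \<longlongrightarrow> 0) F"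
    by simp
  from tendsto_real_sqrt[OF this] show ?thesis by simp
qed

text \<open>
  Weak limits of commuting projections need not be projections (for independent events of probability
  one half, the indicator functions converge weakly to the constant one half). They are projections
  when the projections are indexed by a group with the ascending chain condition on subgroups and the
  indices fixing any given vector form a subgroup.

  If \<open>T\<close> were not idempotent, one could choose \<open>z\<close> with \<open>T (T z) \<noteq> T z\<close> whose group \<open>Fix z\<close> is maximal.
  If \<open>\<phi> a \<in> Fix z\<close> for most \<open>a\<close>, then \<open>T z = z\<close>. Otherwise \<open>\<phi> a \<notin> Fix z\<close> happens frequently, and then the vector
  \<open>W (\<phi> a) z\<close> is fixed by a larger group, so that \<open>T \<circ> T - T\<close> vanishes on it; in the limit
  \<open>T \<circ> T - T\<close> vanishes on \<open>T z\<close>, which for a self-adjoint \<open>T\<close> gives \<open>T (T z) = T z\<close>.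
\<close>

lemma projection_if_fixed_groups_noetherian:
  fixes W :: "'g::ab_group_add \<Rightarrow> 'h::complex_hilbert \<Rightarrow> 'h" and E :: "('g \<Rightarrow> int) set"
  assumes F: "F \<noteq> bot" and T: "wot_tendsto (\<lambda>a. W (\<phi> a)) T F" and \<phi>: "\<And>a. \<phi> a \<in> G"
    and proj: "\<And>g. g \<in> G \<Longrightarrow> orthogonal_projection (W g)"
    and comm: "\<And>g h x. g \<in> G \<Longrightarrow> h \<in> G \<Longrightarrow> W g (W h x) = W h (W g x)"
    and fixed: "\<And>x. additive_subgroup {g \<in> G. W g x = x}"
    and E: "finite E" "\<And>e a b. e \<in> E \<Longrightarrow> e (a - b) = e a - e b"
    and ker: "\<And>g x. g \<in> G \<Longrightarrow> (\<And>e. e \<in> E \<Longrightarrow> e g = 0) \<Longrightarrow> W g x = x"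
  shows "orthogonal_projection T"
proof -
  define Fix where "Fix x = {g \<in> G. W g x = x}" for x
  have lin: "bounded_clinear T" using T by (simp add: wot_tendsto_def)
  have adj: "cinner (T x) y = cinner x (T y)" for x y
    by (rule wot_tendsto_self_adjoint[OF F T]) (rule orthogonal_projectionD(3)[OF proj[OF \<phi>]])
  have "T \<circ> W g = W g \<circ> T" if "g \<in> G" for g
    by (rule wot_tendsto_commute[OF F T orthogonal_projectionD(3)[OF proj[OF that]]])
      (rule comm[OF \<phi> that])
  then have T_W: "T (W g x) = W g (T x)" if "g \<in> G" for g x
    using that by (metis comp_apply)
  have "T (T x) = T x" for x
  proof (rule ccontr)
    assume bad: "T (T x) \<noteq> T x"
    let ?R = "{(H', H). additive_subgroup H \<and> additive_subgroup H' \<and> H \<subset> H' \<and>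
      {a \<in> H'. \<forall>e\<in>E. e a = 0} \<subseteq> H}"
    let ?B = "{Fix x |x. T (T x) \<noteq> T x}"
    have "wf ?R" by (rule wf_subgroups[OF E])
    moreover have "Fix x \<in> ?B" using bad by blast
    ultimately obtain H where "H \<in> ?B" and max: "\<And>H'. (H', H) \<in> ?R \<Longrightarrow> H' \<notin> ?B"
      by (rule wfE_min) auto
    then obtain z where z: "T (T z) \<noteq> T z" and max: "\<And>H'. (H', Fix z) \<in> ?R \<Longrightarrow> H' \<notin> ?B"
      by blast
    have good: "T (T (W (\<phi> a) z)) = T (W (\<phi> a) z)" if a: "\<phi> a \<notin> Fix z" for a
    proof -
      have "W (\<phi> a) (W (\<phi> a) z) = W (\<phi> a) z"
        by (rule orthogonal_projectionD(2)[OF proj[OF \<phi>]])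
      then have in': "\<phi> a \<in> Fix (W (\<phi> a) z)"
        using \<phi> by (simp add: Fix_def)
      have "Fix z \<subseteq> Fix (W (\<phi> a) z)"
      proof
        fix g assume "g \<in> Fix z"
        then have g: "g \<in> G" "W g z = z" by (auto simp: Fix_def)
        then show "g \<in> Fix (W (\<phi> a) z)"
          using comm[OF g(1) \<phi>, of a z] by (simp add: Fix_def)
      qed
      then have "Fix z \<subset> Fix (W (\<phi> a) z)" using in' a by blast
      moreover have "{g \<in> Fix (W (\<phi> a) z). \<forall>e\<in>E. e g = 0} \<subseteq> Fix z"
        using ker by (auto simp: Fix_def)
      ultimately have "(Fix (W (\<phi> a) z), Fix z) \<in> ?R"
        using fixed by (simp add: Fix_def)
      then show ?thesis using max by blast
    qed
    show False
    proof (cases "eventually (\<lambda>a. \<phi> a \<in> Fix z) F")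
      case True
      have "T z = z"
      proof (rule cinner_ext, rule tendsto_unique[OF F wot_tendstoD[OF T]])
        show "((\<lambda>a. cinner (W (\<phi> a) z) y) \<longlongrightarrow> cinner z y) F" for y
          by (rule tendsto_eventually) (use True in \<open>auto simp: Fix_def elim: eventually_mono\<close>)
      qed
      with z show False by simp
    next
      case False
      have "cinner (T (T (T z)) - T (T z)) y = 0" for y
      proof (rule ccontr)
        assume ne: "cinner (T (T (T z)) - T (T z)) y \<noteq> 0"
        have lim: "((\<lambda>a. cinner (W (\<phi> a) z) (T (T y) - T y)) \<longlongrightarrow> cinner (T z) (T (T y) - T y)) F"
          by (rule wot_tendstoD[OF T])
        have swap: "cinner u (T (T y) - T y) = cinner (T (T u) - T u) y" for u
          by (simp add: cinner_diff_left cinner_diff_right adj)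
        have "eventually (\<lambda>a. cinner (W (\<phi> a) z) (T (T y) - T y) \<noteq> 0) F"
          by (rule tendsto_imp_eventually_ne[OF lim]) (use ne in \<open>simp only: swap not_False_eq_True\<close>)
        then have "eventually (\<lambda>a. \<phi> a \<in> Fix z) F"
          by (rule eventually_mono) (metis good swap cinner_zero_left diff_self)
        with False show False ..
      qed
      then have "T (T (T z)) - T (T z) = 0"
        using cinner_ext[of _ 0] cinner_zero_left by metis
      then have "T (T (T z) - T z) = 0"
        by (simp add: bounded_clinearD[OF lin])
      moreover have "T (T z) - T z = T (T z - z)"
        by (simp add: bounded_clinearD[OF lin])
      ultimately have "cinner (T (T z) - T z) (T (T z) - T z) = 0"
        by (metis adj cinner_zero_left cinner_zero_right)
      with z show False by (simp add: cinner_self)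
    qed
  qed
  then show ?thesis
    unfolding orthogonal_projection_def using lin adj by auto
qed

text \<open>
  The van der Corput trick for an idempotent ultrafilter. If the weak limit \<open>z\<close> were nonzero, one
  could choose arbitrarily many vectors \<open>\<xi> (\<alpha>\<^sub>1 \<squnion> \<dots> \<squnion> \<alpha>\<^sub>n \<squnion> \<beta>)\<close>, \<open>\<xi> (\<alpha>\<^sub>2 \<squnion> \<dots> \<squnion> \<beta>)\<close>, \<open>\<dots>\<close>,
  \<open>\<xi> \<beta>\<close> that are almost orthogonal in pairs, although each of them has inner product
  about \<open>(norm z)\<^sup>2\<close> with \<open>z\<close>. The norm of their sum then grows essentially like the square root of their number,
  its inner product with \<open>z\<close> linearly, contrary to the Cauchy-Schwarz inequality. The offsets are found one
  after another as in the Galvin-Glazer proof of Hindman's theorem.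
\<close>

lemma van_der_corput:
  fixes \<xi> :: "'s::semilattice_sup \<Rightarrow> 'h::complex_hilbert"
  assumes F: "F \<noteq> bot" and idem: "bind_filter F (\<lambda>\<alpha>. filtermap (sup \<alpha>) F) = F"
    and weak: "\<And>y. ((\<lambda>\<alpha>. cinner (\<xi> \<alpha>) y) \<longlongrightarrow> cinner z y) F" and bound: "\<And>\<alpha>. norm (\<xi> \<alpha>) \<le> M"
    and corr: "\<And>\<epsilon>. \<epsilon> > 0 \<Longrightarrow>
      \<forall>\<^sub>F \<alpha> in F. \<forall>\<^sub>F \<beta> in F. norm (cinner (\<xi> (sup \<alpha> \<beta>)) (\<xi> \<beta>)) < \<epsilon>"
  shows "z = 0"
proof (rule ccontr)
  assume "z \<noteq> 0"
  define Y where "Y = (norm z)\<^sup>2"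
  have Y: "Y > 0" using \<open>z \<noteq> 0\<close> by (simp add: Y_def)
  \<comment> \<open>Any \<open>\<epsilon>\<close> with \<open>(Y - \<epsilon>)\<^sup>2 > \<epsilon> * Y\<close> makes the last estimate contradictory; here \<open>16/25 > 1/5\<close>.\<close>
  define \<epsilon> where "\<epsilon> = Y / 5"
  have \<epsilon>: "\<epsilon> > 0" using Y by (simp add: \<epsilon>_def)
  have split: "eventually P F \<longleftrightarrow> (\<forall>\<^sub>F \<alpha> in F. \<forall>\<^sub>F \<beta> in F. P (sup \<alpha> \<beta>))" for P
    by (subst idem[symmetric]) (simp add: eventually_bind_filter eventually_filtermap)
  define D where "D \<alpha> \<longleftrightarrow> (\<forall>\<^sub>F \<beta> in F. norm (cinner (\<xi> (sup \<alpha> \<beta>)) (\<xi> \<beta>)) < \<epsilon>)" for \<alpha>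
  \<comment> \<open>Unlike \<open>D\<close>, the set \<open>D'\<close> is preserved when a generic \<open>\<beta>\<close> is joined to one of its members.\<close>
  define D' where "D' \<alpha> \<longleftrightarrow> D \<alpha> \<and> (\<forall>\<^sub>F \<beta> in F. D (sup \<alpha> \<beta>))" for \<alpha>
  have D: "eventually D F" unfolding D_def by (rule corr[OF \<epsilon>])
  have D'_F: "eventually D' F"
    unfolding D'_def by (intro eventually_conj D) (use D split[of D] in simp)
  have D'_sup: "\<forall>\<^sub>F \<beta> in F. D' (sup \<alpha> \<beta>)" if "D' \<alpha>" for \<alpha>
  proof -
    have "\<forall>\<^sub>F \<beta> in F. D (sup \<alpha> \<beta>)" using that by (simp add: D'_def)
    moreover from this have "\<forall>\<^sub>F \<beta> in F. \<forall>\<^sub>F \<gamma> in F. D (sup (sup \<alpha> \<beta>) \<gamma>)"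
      using split[of "\<lambda>\<beta>. D (sup \<alpha> \<beta>)"] by (simp add: sup_assoc)
    ultimately show ?thesis unfolding D'_def by (rule eventually_conj)
  qed
  define u where "u ds \<beta> = (\<Sum>\<delta>\<leftarrow>ds. \<xi> (sup \<delta> \<beta>)) + \<xi> \<beta>" for ds \<beta>
  have Re_weak: "\<forall>\<^sub>F \<beta> in F. Y - \<epsilon> < Re (cinner (\<xi> \<beta>) z)"
  proof -
    have "((\<lambda>\<beta>. Re (cinner (\<xi> \<beta>) z)) \<longlongrightarrow> Y) F"
      using tendsto_Re[OF weak[of z]] by (simp add: Y_def cinner_self)
    then show ?thesis by (rule order_tendstoD) (use \<epsilon> in simp)
  qed
  \<comment> \<open>For most \<open>\<beta>\<close> the \<open>n + 1\<close> summands of \<open>u ds \<beta>\<close> are almost orthogonal to each other,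
    and each has inner product about \<open>Y\<close> with \<open>z\<close>.\<close>
  have chain: "\<exists>ds. length ds = n \<and> (\<forall>\<delta>\<in>set ds. D' \<delta>) \<and>
    (\<forall>\<^sub>F \<beta> in F. (norm (u ds \<beta>))\<^sup>2 \<le> real (Suc n) * M\<^sup>2 + (real (Suc n))\<^sup>2 * \<epsilon> \<and>
      real (Suc n) * (Y - \<epsilon>) \<le> Re (cinner (u ds \<beta>) z))" for n
  proof (induction n)
    case 0
    from Re_weak have "\<forall>\<^sub>F \<beta> in F. (norm (\<xi> \<beta>))\<^sup>2 \<le> M\<^sup>2 + \<epsilon> \<and> Y - \<epsilon> \<le> Re (cinner (\<xi> \<beta>) z)"
    proof eventually_elim
      case (elim \<beta>)
      have "(norm (\<xi> \<beta>))\<^sup>2 \<le> M\<^sup>2" using bound by (intro power_mono) auto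
      then show ?case using elim \<epsilon> by auto
    qed
    then show ?case by (intro exI[of _ "[]"]) (simp add: u_def)
  next
    case (Suc n)
    define N where "N = real (Suc n)"
    from Suc obtain ds where ds: "length ds = n" "\<forall>\<delta>\<in>set ds. D' \<delta>" and
      good: "\<forall>\<^sub>F \<beta> in F. (norm (u ds \<beta>))\<^sup>2 \<le> N * M\<^sup>2 + N\<^sup>2 * \<epsilon> \<and> N * (Y - \<epsilon>) \<le> Re (cinner (u ds \<beta>) z)"
      unfolding N_def by blast
    have "\<forall>\<^sub>F \<alpha> in F. \<forall>\<delta>\<in>set ds. D' (sup \<delta> \<alpha>)"
      using ds(2) D'_sup by (intro eventually_ball_finite) auto
    moreover have "\<forall>\<^sub>F \<alpha> in F. \<forall>\<^sub>F \<beta> in F. (norm (u ds (sup \<alpha> \<beta>)))\<^sup>2 \<le> N * M\<^sup>2 + N\<^sup>2 * \<epsilon> \<and>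
        N * (Y - \<epsilon>) \<le> Re (cinner (u ds (sup \<alpha> \<beta>)) z)"
      using good by (subst (asm) split)
    ultimately have "\<forall>\<^sub>F \<alpha> in F. D' \<alpha> \<and> (\<forall>\<delta>\<in>set ds. D' (sup \<delta> \<alpha>)) \<and>
      (\<forall>\<^sub>F \<beta> in F. (norm (u ds (sup \<alpha> \<beta>)))\<^sup>2 \<le> N * M\<^sup>2 + N\<^sup>2 * \<epsilon> \<and>
        N * (Y - \<epsilon>) \<le> Re (cinner (u ds (sup \<alpha> \<beta>)) z))"
      using D'_F by (intro eventually_conj)
    then obtain \<alpha> where \<alpha>: "D' \<alpha>" "\<forall>\<delta>\<in>set ds. D' (sup \<delta> \<alpha>)" and
      good': "\<forall>\<^sub>F \<beta> in F. (norm (u ds (sup \<alpha> \<beta>)))\<^sup>2 \<le> N * M\<^sup>2 + N\<^sup>2 * \<epsilon> \<and>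
        N * (Y - \<epsilon>) \<le> Re (cinner (u ds (sup \<alpha> \<beta>)) z)"
      using eventually_happens'[OF F] by blast
    \<comment> \<open>Joining \<open>\<alpha>\<close> to the argument turns the previous sum into \<open>n + 1\<close> vectors; the new
      vector \<open>\<xi> \<beta>\<close> is almost orthogonal to all of them since their offsets lie in \<open>D\<close>.\<close>
    define ds' where "ds' = map (\<lambda>\<delta>. sup \<delta> \<alpha>) ds @ [\<alpha>]"
    have len: "length ds' = Suc n" and D'_ds': "\<forall>\<delta>\<in>set ds'. D' \<delta>"
      using ds \<alpha> by (auto simp: ds'_def)
    have u_eq: "u ds (sup \<alpha> \<beta>) = (\<Sum>\<delta>\<leftarrow>ds'. \<xi> (sup \<delta> \<beta>))" for \<beta>
      by (simp add: u_def ds'_def comp_def sup_assoc)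
    have "\<forall>\<^sub>F \<beta> in F. \<forall>\<delta>\<in>set ds'. norm (cinner (\<xi> (sup \<delta> \<beta>)) (\<xi> \<beta>)) < \<epsilon>"
      using D'_ds' by (intro eventually_ball_finite) (auto simp: D'_def D_def)
    with good' Re_weak have "\<forall>\<^sub>F \<beta> in F. (norm (u ds' \<beta>))\<^sup>2 \<le> real (Suc (Suc n)) * M\<^sup>2 + (real (Suc (Suc n)))\<^sup>2 * \<epsilon> \<and>
      real (Suc (Suc n)) * (Y - \<epsilon>) \<le> Re (cinner (u ds' \<beta>) z)"
    proof eventually_elim
      case (elim \<beta>)
      let ?v = "\<Sum>\<delta>\<leftarrow>ds'. \<xi> (sup \<delta> \<beta>)"
      have N': "real (Suc (Suc n)) = N + 1" by (simp add: N_def)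
      have u': "u ds' \<beta> = ?v + \<xi> \<beta>" by (simp add: u_def)
      have v: "(norm ?v)\<^sup>2 \<le> N * M\<^sup>2 + N\<^sup>2 * \<epsilon>" "N * (Y - \<epsilon>) \<le> Re (cinner ?v z)"
        using elim(1) by (auto simp: u_eq)
      have "Re (cinner (\<Sum>\<delta>\<leftarrow>es. \<xi> (sup \<delta> \<beta>)) (\<xi> \<beta>)) \<le> real (length es) * \<epsilon>"
        if "set es \<subseteq> set ds'" for es
        using that
      proof (induction es)
        case (Cons \<delta> es)
        have "Re (cinner (\<xi> (sup \<delta> \<beta>)) (\<xi> \<beta>)) \<le> \<epsilon>"
          using elim(3) Cons.prems complex_Re_le_cmod[of "cinner (\<xi> (sup \<delta> \<beta>)) (\<xi> \<beta>)"]
          by force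
        with Cons show ?case by (simp add: cinner_add_left distrib_right)
      qed simp
      from this[of ds'] have "Re (cinner ?v (\<xi> \<beta>)) \<le> N * \<epsilon>"
        by (simp add: len N_def)
      moreover have "(norm (\<xi> \<beta>))\<^sup>2 \<le> M\<^sup>2" using bound by (intro power_mono) auto
      moreover have "(N + 1)\<^sup>2 * \<epsilon> = N\<^sup>2 * \<epsilon> + 2 * (N * \<epsilon>) + \<epsilon>"
        by (simp add: power2_eq_square algebra_simps)
      moreover have "(N + 1) * M\<^sup>2 = N * M\<^sup>2 + M\<^sup>2" by (simp add: algebra_simps)
      ultimately have "(norm (u ds' \<beta>))\<^sup>2 \<le> (N + 1) * M\<^sup>2 + (N + 1)\<^sup>2 * \<epsilon>"
        unfolding u' norm_add_sq using v(1) \<epsilon> by argo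
      moreover have "(N + 1) * (Y - \<epsilon>) \<le> Re (cinner (u ds' \<beta>) z)"
        unfolding u' cinner_add_left distrib_right using v(2) elim(2) by simp
      ultimately show ?case unfolding N' by blast
    qed
    then show ?case
      using len D'_ds' by blast
  qed
  have ineq: "(16/25) * real (Suc n) * Y \<le> M\<^sup>2 + real (Suc n) * (Y / 5)" for n
  proof -
    define N where "N = real (Suc n)"
    have N: "N > 0" by (simp add: N_def)
    from chain[of n] obtain ds where "\<forall>\<^sub>F \<beta> in F. (norm (u ds \<beta>))\<^sup>2 \<le> N * M\<^sup>2 + N\<^sup>2 * \<epsilon> \<and>
      N * (Y - \<epsilon>) \<le> Re (cinner (u ds \<beta>) z)"
      unfolding N_def by blast
    then obtain v where v: "(norm v)\<^sup>2 \<le> N * M\<^sup>2 + N\<^sup>2 * \<epsilon>" "N * (Y - \<epsilon>) \<le> Re (cinner v z)"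
      using eventually_happens'[OF F] by blast
    have "N * (Y - \<epsilon>) \<le> norm v * norm z"
      using v(2) complex_Re_le_cmod[of "cinner v z"] cauchy_schwarz[of v z] by linarith
    moreover have "0 \<le> N * (Y - \<epsilon>)" using N Y by (simp add: \<epsilon>_def)
    ultimately have "(N * (Y - \<epsilon>))\<^sup>2 \<le> (norm v * norm z)\<^sup>2" by (intro power_mono)
    also have "\<dots> = (norm v)\<^sup>2 * Y" by (simp add: power_mult_distrib Y_def)
    also have "\<dots> \<le> (N * M\<^sup>2 + N\<^sup>2 * \<epsilon>) * Y" using v(1) Y by (intro mult_right_mono) auto
    finally have "(N * Y) * ((16/25) * N * Y) \<le> (N * Y) * (M\<^sup>2 + N * (Y / 5))"
      by (simp add: \<epsilon>_def power2_eq_square algebra_simps)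
    then show ?thesis
      unfolding N_def[symmetric] by (rule mult_left_le_imp_le) (use N Y in simp)
  qed
  have *: "real (Suc n) * ((11/25) * Y) \<le> M\<^sup>2" for n
    using ineq[of n] by (simp add: field_simps)
  obtain n where "M\<^sup>2 < real n * ((11/25) * Y)"
    using reals_Archimedean3[of "(11/25) * Y"] Y by auto
  also have "\<dots> \<le> real (Suc n) * ((11/25) * Y)"
    using Y by (intro mult_right_mono) auto
  also have "\<dots> \<le> M\<^sup>2" by (rule *)
  finally show False by simp
qed


section \<open>Polynomial exponents in one vector variable\<close>

text \<open>
  A unitary representation of an abelian group of exponents that factors through finitely many integer
  coordinates. It stands for \<open>e \<mapsto> U\<^sub>1\<^bsup>e 1\<^esup> \<circ> \<dots> \<circ> U\<^sub>m\<^bsup>e m\<^esup>\<close>, where the characters are the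
  coordinates \<open>1, \<dots>, m\<close>.
\<close>

locale unitary_rep =
  fixes V :: "'e::ab_group_add \<Rightarrow> 'h::complex_hilbert \<Rightarrow> 'h"
    and Chars :: "('e \<Rightarrow> int) set"
  assumes V_add: "V (a + b) x = V a (V b x)"
    and V_zero: "V 0 x = x"
    and V_unitary: "unitary_op (V a)"
    and finite_Chars: "finite Chars"
    and Chars_diff: "\<kappa> \<in> Chars \<Longrightarrow> \<kappa> (a - b) = \<kappa> a - \<kappa> b"
    and V_trivial: "(\<And>\<kappa>. \<kappa> \<in> Chars \<Longrightarrow> \<kappa> a = 0) \<Longrightarrow> V a x = x"
begin

lemma V_lin: "bounded_clinear (V a)" and V_cinner: "cinner (V a x) (V a y) = cinner x y"
  using V_unitary[of a] by (auto simp: unitary_op_def)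

lemma V_norm: "norm (V a x) = norm x"
proof -
  have "(norm (V a x))\<^sup>2 = (norm x)\<^sup>2"
    by (simp add: norm_eq_Re_cinner V_cinner)
  then show ?thesis by simp
qed

lemma V_contraction: "contraction (V a)"
  by (simp add: contraction_def V_lin V_norm)

lemma V_adjoint: "cinner (V a x) y = cinner x (V (- a) y)"
  by (metis V_add V_cinner V_zero add.right_inverse)

lemma V_commute: "V a (V b x) = V b (V a x)"
  by (metis V_add add.commute)

lemma V_diff: "V a (x - y) = V a x - V a y"
  by (rule bounded_clinearD(2)[OF V_lin])

definition lim_op :: "'s filter \<Rightarrow> ('s \<Rightarrow> 'e) \<Rightarrow> 'h \<Rightarrow> 'h"
  where "lim_op F h = (SOME L. wot_tendsto (\<lambda>\<alpha>. V (h \<alpha>)) L F)"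

lemma wot_tendsto_lim_op:
  assumes "ultra F"
  shows "wot_tendsto (\<lambda>\<alpha>. V (h \<alpha>)) (lim_op F h) F"
proof -
  have "\<exists>L. wot_tendsto (\<lambda>\<alpha>. V (h \<alpha>)) L F"
    by (rule wot_limit_exists[OF assms V_contraction])
  then show ?thesis unfolding lim_op_def by (rule someI_ex)
qed

lemma lim_op_contraction: "ultra F \<Longrightarrow> contraction (lim_op F h)"
  by (rule wot_tendsto_contraction[OF ultra_not_bot wot_tendsto_lim_op]) (auto intro: V_contraction)

lemma lim_op_V: "ultra F \<Longrightarrow> lim_op F h (V a x) = V a (lim_op F h x)"
  using wot_tendsto_commute[OF ultra_not_bot wot_tendsto_lim_op, of F "V a" "V (- a)" h]
  by (auto simp: V_adjoint V_commute fun_eq_iff)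

lemma lim_op_commute:
  assumes F: "ultra F" and B: "orthogonal_projection B" "\<And>a x. B (V a x) = V a (B x)"
  shows "lim_op F h (B x) = B (lim_op F h x)"
proof -
  have "lim_op F h \<circ> B = B \<circ> lim_op F h"
    by (rule wot_tendsto_commute[OF ultra_not_bot[OF F] wot_tendsto_lim_op[OF F]
          orthogonal_projectionD(3)[OF B(1)]]) (simp add: B(2))
  then show ?thesis by (metis comp_apply)
qed

lemma lim_op_constant:
  assumes F: "ultra F" and "\<And>\<alpha>. V (h \<alpha>) x = x"
  shows "lim_op F h x = x"
proof (rule cinner_ext, rule tendsto_unique[OF ultra_not_bot[OF F]])
  show "((\<lambda>\<alpha>. cinner (V (h \<alpha>) x) y) \<longlongrightarrow> cinner (lim_op F h x) y) F" for y
    by (rule wot_tendstoD[OF wot_tendsto_lim_op[OF F]])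
  show "((\<lambda>\<alpha>. cinner (V (h \<alpha>) x) y) \<longlongrightarrow> cinner x y) F" for y
    by (simp add: assms)
qed

text \<open>
  For unitary operators the distance to a fixed vector is governed by an inner product, so weak limits
  determine limits of distances.
\<close>

lemma norm_V_diff_limit:
  assumes F: "ultra F"
  shows "((\<lambda>\<alpha>. norm (V (h \<alpha>) x - x)) \<longlongrightarrow> sqrt (2 * (norm x)\<^sup>2 - 2 * Re (cinner (lim_op F h x) x))) F"
proof -
  have "norm (V (h \<alpha>) x - x) = sqrt (2 * (norm x)\<^sup>2 - 2 * Re (cinner (V (h \<alpha>) x) x))" for \<alpha>
  proof -
    have "(norm (V (h \<alpha>) x - x))\<^sup>2 = 2 * (norm x)\<^sup>2 - 2 * Re (cinner (V (h \<alpha>) x) x)"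
      by (simp add: norm_diff_sq V_norm)
    then show ?thesis by (metis norm_ge_zero real_sqrt_unique)
  qed
  moreover have "((\<lambda>\<alpha>. sqrt (2 * (norm x)\<^sup>2 - 2 * Re (cinner (V (h \<alpha>) x) x)))
      \<longlongrightarrow> sqrt (2 * (norm x)\<^sup>2 - 2 * Re (cinner (lim_op F h x) x))) F"
    by (intro tendsto_intros tendsto_Re wot_tendstoD[OF wot_tendsto_lim_op[OF F]])
  ultimately show ?thesis by simp
qed

text \<open>
  A vector fixed by the weak limit of unitary operators is almost fixed by the operators themselves, in
  norm; hence the exponent functions whose limit fixes a given vector form a group.
\<close>

lemma lim_op_fixed_iff:
  assumes F: "ultra F"
  shows "lim_op F h x = x \<longleftrightarrow> ((\<lambda>\<alpha>. norm (V (h \<alpha>) x - x)) \<longlongrightarrow> 0) F"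
proof
  assume "lim_op F h x = x"
  then show "((\<lambda>\<alpha>. norm (V (h \<alpha>) x - x)) \<longlongrightarrow> 0) F"
    using norm_V_diff_limit[OF F, of h x] by (simp add: norm_eq_Re_cinner)
next
  assume lim: "((\<lambda>\<alpha>. norm (V (h \<alpha>) x - x)) \<longlongrightarrow> 0) F"
  show "lim_op F h x = x"
  proof (rule cinner_ext, rule tendsto_unique[OF ultra_not_bot[OF F]])
    fix y
    show "((\<lambda>\<alpha>. cinner (V (h \<alpha>) x) y) \<longlongrightarrow> cinner (lim_op F h x) y) F"
      by (rule wot_tendstoD[OF wot_tendsto_lim_op[OF F]])
    have "((\<lambda>\<alpha>. cinner (V (h \<alpha>) x) y - cinner x y) \<longlongrightarrow> 0) F"
    proof (rule Lim_null_comparison)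
      show "\<forall>\<^sub>F \<alpha> in F. norm (cinner (V (h \<alpha>) x) y - cinner x y) \<le> norm (V (h \<alpha>) x - x) * norm y"
        by (intro always_eventually allI)
          (simp only: cinner_diff_left[symmetric] cauchy_schwarz)
      show "((\<lambda>\<alpha>. norm (V (h \<alpha>) x - x) * norm y) \<longlongrightarrow> 0) F"
        using lim by (intro tendsto_mult_left_zero)
    qed
    then show "((\<lambda>\<alpha>. cinner (V (h \<alpha>) x) y) \<longlongrightarrow> cinner x y) F"
      by (rule LIM_zero_cancel)
  qed
qed

lemma lim_op_fixed_diff:
  assumes F: "ultra F" and "lim_op F h x = x" "lim_op F k x = x"
  shows "lim_op F (\<lambda>\<alpha>. h \<alpha> - k \<alpha>) x = x"
proof -
  have le: "norm (V (h \<alpha> - k \<alpha>) x - x) \<le> norm (V (h \<alpha>) x - x) + norm (V (k \<alpha>) x - x)" for \<alpha>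
  proof -
    have "V (k \<alpha>) (V (h \<alpha> - k \<alpha>) x - x) = V (h \<alpha>) x - V (k \<alpha>) x"
      by (simp add: V_diff V_add[symmetric])
    then have "norm (V (h \<alpha> - k \<alpha>) x - x) = norm (V (h \<alpha>) x - V (k \<alpha>) x)"
      by (metis V_norm)
    then show ?thesis
      using norm_triangle_ineq4[of "V (h \<alpha>) x - x" "V (k \<alpha>) x - x"] by simp
  qed
  have lim: "((\<lambda>\<alpha>. norm (V (h \<alpha>) x - x) + norm (V (k \<alpha>) x - x)) \<longlongrightarrow> 0) F"
    using assms by (intro tendsto_add_zero) (simp_all add: lim_op_fixed_iff)
  have "((\<lambda>\<alpha>. norm (V (h \<alpha> - k \<alpha>) x - x)) \<longlongrightarrow> 0) F"
    by (rule Lim_null_comparison[OF _ lim]) (simp add: le)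
  then show ?thesis by (simp add: lim_op_fixed_iff[OF F])
qed

text \<open>
  For polynomial exponents of bounded degree, the limits of the single operators are indexed by a group
  with the ascending chain condition: finitely many evaluations followed by characters separate its
  elements. If these limits are projections, so is every weak limit of a family of them.
\<close>

lemma projection_limit_of_polynomial_family:
  fixes v :: "'s \<Rightarrow> 'v \<Rightarrow> int" and \<phi> :: "'a \<Rightarrow> ('v \<Rightarrow> int) \<Rightarrow> 'e"
  assumes F: "ultra F" and X: "finite X" and v: "\<And>\<alpha> i. i \<notin> X \<Longrightarrow> v \<alpha> i = 0"
    and proj: "\<And>g. frechet d g \<Longrightarrow> g 0 = 0 \<Longrightarrow> orthogonal_projection (lim_op F (\<lambda>\<alpha>. g (v \<alpha>)))"
    and H: "H \<noteq> bot" and \<phi>: "\<And>a. frechet d (\<phi> a)" "\<And>a. \<phi> a 0 = 0"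
    and R: "wot_tendsto (\<lambda>a. lim_op F (\<lambda>\<alpha>. \<phi> a (v \<alpha>))) R H"
  shows "orthogonal_projection R"
proof -
  from frechet_determined_by_finitely_many_points[OF X, of d]
  obtain S where S: "finite S" and "\<forall>g :: ('v \<Rightarrow> int) \<Rightarrow> int. frechet d g \<longrightarrow> g 0 = 0 \<longrightarrow>
      (\<forall>x\<in>S. g x = 0) \<longrightarrow> (\<forall>x. (\<forall>i. i \<notin> X \<longrightarrow> x i = 0) \<longrightarrow> g x = 0)"
    by (elim exE conjE)
  note det = this(2)[rule_format]
  define G where "G = {g :: ('v \<Rightarrow> int) \<Rightarrow> 'e. frechet d g \<and> g 0 = 0}"
  define W where "W g = lim_op F (\<lambda>\<alpha>. g (v \<alpha>))" for g
  define E where "E = (\<lambda>(\<kappa>, p) (g :: ('v \<Rightarrow> int) \<Rightarrow> 'e). \<kappa> (g p)) ` (Chars \<times> S)"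
  have projW: "orthogonal_projection (W g)" if "g \<in> G" for g
    using that proj by (auto simp: G_def W_def)
  show ?thesis
  proof (rule projection_if_fixed_groups_noetherian[where W = W and G = G and E = E and \<phi> = \<phi>])
    show "H \<noteq> bot" by (rule H)
    show "wot_tendsto (\<lambda>a. W (\<phi> a)) R H" using R by (simp add: W_def)
    show "\<phi> a \<in> G" for a using \<phi> by (simp add: G_def)
    show "orthogonal_projection (W g)" if "g \<in> G" for g by (rule projW[OF that])
    show "W g (W h x) = W h (W g x)" if "g \<in> G" "h \<in> G" for g h x
      unfolding W_def[of g]
      by (rule lim_op_commute[OF F projW[OF that(2)]]) (simp add: W_def lim_op_V[OF F])
    show "additive_subgroup {g \<in> G. W g x = x}" for x
      unfolding additive_subgroup_def
    proof (intro conjI ballI)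
      have "W 0 x = x" unfolding W_def by (intro lim_op_constant[OF F]) (simp add: V_zero)
      then show "0 \<in> {g \<in> G. W g x = x}" by (simp add: G_def frechet_zero zero_fun_def)
      fix g h assume "g \<in> {g \<in> G. W g x = x}" "h \<in> {g \<in> G. W g x = x}"
      then show "g - h \<in> {g \<in> G. W g x = x}"
        using lim_op_fixed_diff[OF F, of "\<lambda>\<alpha>. g (v \<alpha>)" x "\<lambda>\<alpha>. h (v \<alpha>)"]
        by (auto simp: G_def W_def fun_diff_def intro: frechet_diff)
    qed
    show "finite E" unfolding E_def using S finite_Chars by simp
    show "e (a - b) = e a - e b" if "e \<in> E" for e a b
      using that Chars_diff by (auto simp: E_def)
    show "W g x = x" if g: "g \<in> G" and e: "\<And>e. e \<in> E \<Longrightarrow> e g = 0" for g x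
      unfolding W_def
    proof (rule lim_op_constant[OF F], rule V_trivial)
      fix \<alpha> \<kappa> assume \<kappa>: "\<kappa> \<in> Chars"
      show "\<kappa> (g (v \<alpha>)) = 0"
      proof (rule det[where g = "\<lambda>p. \<kappa> (g p)"])
        show "frechet d (\<lambda>p. \<kappa> (g p))"
          by (rule frechet_additive_comp[where \<kappa> = \<kappa>])
            (use g Chars_diff[OF \<kappa>] in \<open>simp_all add: G_def\<close>)
        show "\<kappa> (g 0) = 0" using g Chars_diff[OF \<kappa>, of 0 0] by (simp add: G_def)
        show "\<kappa> (g p) = 0" if "p \<in> S" for p
          using e[of "\<lambda>g. \<kappa> (g p)"] that \<kappa> by (force simp: E_def)
        show "v \<alpha> i = 0" if "i \<notin> X" for i by (rule v[OF that])
      qed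
    qed
  qed
qed

text \<open>
  Induction on the degree. With \<open>D \<alpha>\<close> the polarized difference,
  \<open>g (v (\<alpha> \<squnion> \<beta>)) = g (v \<alpha>) + g (v \<beta>) + D \<alpha> (v \<beta>)\<close> for most \<open>\<alpha>\<close> and \<open>\<beta>\<close>.
  As \<open>D \<alpha>\<close> has lower degree, its limit \<open>Q \<alpha>\<close> is a projection, and therefore so is the limit \<open>R\<close> of
  the \<open>Q \<alpha>\<close>. On the range of \<open>R\<close> the factor \<open>V (D \<alpha> (v \<beta>))\<close> is asymptotically the identity, so
  splitting \<open>\<gamma>\<close> into \<open>\<alpha> \<squnion> \<beta>\<close> shows \<open>P x = P (P x)\<close>. On the kernel of \<open>R\<close> the correlation of
  \<open>V (g (v (\<alpha> \<squnion> \<beta>))) x\<close> with \<open>V (g (v \<beta>)) x\<close> tends to the inner product of \<open>V (g (v \<alpha>)) (Q \<alpha> x)\<close> with \<open>x\<close>,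
  which is small, and the van der Corput trick gives \<open>P x = 0\<close>.
\<close>

theorem projection_one_variable:
  fixes v :: "'s::semilattice_sup \<Rightarrow> 'v \<Rightarrow> int" and g :: "('v \<Rightarrow> int) \<Rightarrow> 'e"
  assumes F: "ultra F" and idem: "bind_filter F (\<lambda>\<alpha>. filtermap (sup \<alpha>) F) = F"
    and X: "finite X" and v: "\<And>\<alpha> i. i \<notin> X \<Longrightarrow> v \<alpha> i = 0"
    and v_add: "\<forall>\<^sub>F \<alpha> in F. \<forall>\<^sub>F \<beta> in F. v (sup \<alpha> \<beta>) = v \<alpha> + v \<beta>"
    and g: "frechet d g" "g 0 = 0"
  shows "orthogonal_projection (lim_op F (\<lambda>\<alpha>. g (v \<alpha>)))"
  using g
proof (induction d arbitrary: g)
  case 0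
  then have "lim_op F (\<lambda>\<alpha>. g (v \<alpha>)) = id"
    using lim_op_constant[OF F, of "\<lambda>\<alpha>. g (v \<alpha>)"] by (auto simp: V_zero)
  then show ?case by (simp only: projection_id)
next
  case (Suc d)
  note bot = ultra_not_bot[OF F]
  define D where "D \<alpha> b = g (v \<alpha> + b) - g b - g (v \<alpha>)" for \<alpha> b
  define Q where "Q \<alpha> = lim_op F (\<lambda>\<beta>. D \<alpha> (v \<beta>))" for \<alpha>
  define P where "P = lim_op F (\<lambda>\<alpha>. g (v \<alpha>))"
  have D: "frechet d (D \<alpha>)" "D \<alpha> 0 = 0" for \<alpha>
    unfolding D_def by (rule frechet_derivative_pointed[of d g, OF Suc.prems]) (simp only: Suc.prems(2) add_0_right diff_zero diff_self)
  have projQ: "orthogonal_projection (Q \<alpha>)" for \<alpha>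
    unfolding Q_def by (rule Suc.IH[OF D])
  have limQ: "wot_tendsto (\<lambda>\<beta>. V (D \<alpha> (v \<beta>))) (Q \<alpha>) F" for \<alpha>
    unfolding Q_def by (rule wot_tendsto_lim_op[OF F])
  have limP: "wot_tendsto (\<lambda>\<alpha>. V (g (v \<alpha>))) P F"
    unfolding P_def by (rule wot_tendsto_lim_op[OF F])
  have split: "\<forall>\<^sub>F \<alpha> in F. \<forall>\<^sub>F \<beta> in F. g (v (sup \<alpha> \<beta>)) = g (v \<alpha>) + g (v \<beta>) + D \<alpha> (v \<beta>)"
    using v_add
    by eventually_elim (auto elim!: eventually_mono simp: D_def)
  obtain R where R: "wot_tendsto Q R F"
    using wot_limit_exists[OF F] orthogonal_projectionD(6)[OF projQ] by blast
  have projR: "orthogonal_projection R"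
  proof (rule projection_limit_of_polynomial_family[where v = v and d = d and \<phi> = D and X = X and F = F and H = F])
    show "orthogonal_projection (lim_op F (\<lambda>\<alpha>. h (v \<alpha>)))" if "frechet d h" "h 0 = 0"
      for h :: "('v \<Rightarrow> int) \<Rightarrow> 'e"
      by (rule Suc.IH[OF that])
    show "wot_tendsto (\<lambda>\<alpha>. lim_op F (\<lambda>\<beta>. D \<alpha> (v \<beta>))) R F"
      using R by (simp add: Q_def[abs_def])
  qed (fact F X v bot D)+
  have "R \<circ> V a = V a \<circ> R" for a
    by (rule wot_tendsto_commute[OF bot R V_adjoint]) (simp add: Q_def lim_op_V[OF F])
  then have R_V: "R (V a x) = V a (R x)" for a x by (metis comp_apply)
  have PR: "P (R x) = R (P x)" for x
    unfolding P_def by (rule lim_op_commute[OF F projR R_V])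
  have contP: "contraction P" unfolding P_def by (rule lim_op_contraction[OF F])
  then have linP: "bounded_clinear P" by (simp add: contraction_def)
  have on_range: "P x = P (P x)" if x: "R x = x" for x
  proof (rule cinner_ext, rule tendsto_unique[OF bot wot_tendstoD[OF limP]])
    fix y
    have main: "((\<lambda>(\<alpha>, \<beta>). cinner (V (g (v \<alpha>)) (V (g (v \<beta>)) x)) y) \<longlongrightarrow> cinner (P (P x)) y) (pair_filter F F)"
    proof (rule tendsto_pair_filter)
      show "((\<lambda>\<beta>. cinner (V (g (v \<alpha>)) (V (g (v \<beta>)) x)) y) \<longlongrightarrow> cinner (V (g (v \<alpha>)) (P x)) y) F" for \<alpha>
        unfolding V_adjoint[of "g (v \<alpha>)"] by (rule wot_tendstoD[OF limP])
      show "((\<lambda>\<alpha>. cinner (V (g (v \<alpha>)) (P x)) y) \<longlongrightarrow> cinner (P (P x)) y) F"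
        by (rule wot_tendstoD[OF limP])
    qed
    have err: "((\<lambda>(\<alpha>, \<beta>). norm (V (D \<alpha> (v \<beta>)) x - x)) \<longlongrightarrow> 0) (pair_filter F F)"
    proof (rule tendsto_pair_filter)
      show "((\<lambda>\<beta>. norm (V (D \<alpha> (v \<beta>)) x - x)) \<longlongrightarrow> sqrt (2 * (norm x)\<^sup>2 - 2 * Re (cinner (Q \<alpha> x) x))) F" for \<alpha>
        unfolding Q_def by (rule norm_V_diff_limit[OF F])
      have "((\<lambda>\<alpha>. sqrt (2 * (norm x)\<^sup>2 - 2 * Re (cinner (Q \<alpha> x) x)))
          \<longlongrightarrow> sqrt (2 * (norm x)\<^sup>2 - 2 * Re (cinner (R x) x))) F"
        by (intro tendsto_intros tendsto_Re wot_tendstoD[OF R])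
      then show "((\<lambda>\<alpha>. sqrt (2 * (norm x)\<^sup>2 - 2 * Re (cinner (Q \<alpha> x) x))) \<longlongrightarrow> 0) F"
        by (simp add: x norm_eq_Re_cinner)
    qed
    have bound: "norm (cinner (V (g (v \<alpha>)) (V (g (v \<beta>)) x)) y - cinner (V (g (v (sup \<alpha> \<beta>))) x) y)
        \<le> norm (V (D \<alpha> (v \<beta>)) x - x) * norm y"
      if eq: "g (v (sup \<alpha> \<beta>)) = g (v \<alpha>) + g (v \<beta>) + D \<alpha> (v \<beta>)" for \<alpha> \<beta>
    proof -
      have "cinner (V (g (v \<alpha>)) (V (g (v \<beta>)) x)) y - cinner (V (g (v (sup \<alpha> \<beta>))) x) y =
        cinner (V (g (v \<alpha>)) (V (g (v \<beta>)) (x - V (D \<alpha> (v \<beta>)) x))) y"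
        unfolding eq V_add V_diff cinner_diff_left ..
      also have "norm \<dots> \<le> norm (x - V (D \<alpha> (v \<beta>)) x) * norm y"
        using cauchy_schwarz[of "V (g (v \<alpha>)) (V (g (v \<beta>)) (x - V (D \<alpha> (v \<beta>)) x))" y]
        by (simp add: V_norm)
      finally show ?thesis
        by (simp only: norm_minus_commute)
    qed
    have "\<forall>\<^sub>F p in pair_filter F F. norm (case p of (\<alpha>, \<beta>) \<Rightarrow>
          cinner (V (g (v \<alpha>)) (V (g (v \<beta>)) x)) y - cinner (V (g (v (sup \<alpha> \<beta>))) x) y)
        \<le> (case p of (\<alpha>, \<beta>) \<Rightarrow> norm (V (D \<alpha> (v \<beta>)) x - x)) * norm y"
      unfolding eventually_pair_filter prod.case using split
      by (rule eventually_mono) (erule eventually_mono, erule bound)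
    then have "((\<lambda>(\<alpha>, \<beta>). cinner (V (g (v \<alpha>)) (V (g (v \<beta>)) x)) y - cinner (V (g (v (sup \<alpha> \<beta>))) x) y)
        \<longlongrightarrow> 0) (pair_filter F F)"
      by (rule Lim_null_comparison) (rule tendsto_mult_left_zero[OF err])
    from tendsto_diff[OF main this]
    have "((\<lambda>(\<alpha>, \<beta>). cinner (V (g (v (sup \<alpha> \<beta>))) x) y) \<longlongrightarrow> cinner (P (P x)) y) (pair_filter F F)"
      by (simp add: case_prod_unfold)
    then show "((\<lambda>\<alpha>. cinner (V (g (v \<alpha>)) x) y) \<longlongrightarrow> cinner (P (P x)) y) F"
      by (rule tendsto_idempotent_filter[OF idem])
  qed
  have on_kernel: "P x = 0" if x: "R x = 0" for x
  proof (rule van_der_corput[OF bot idem wot_tendstoD[OF limP]])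
    show "norm (V (g (v \<alpha>)) x) \<le> norm x" for \<alpha> by (simp add: V_norm)
    fix \<epsilon> :: real assume \<epsilon>: "\<epsilon> > 0"
    have "((\<lambda>\<alpha>. norm (Q \<alpha> x) * norm x) \<longlongrightarrow> 0) F"
      using projections_strong_limit[OF R projQ projR, of x] unfolding x
      by (intro tendsto_mult_left_zero) simp
    then have "\<forall>\<^sub>F \<alpha> in F. norm (Q \<alpha> x) * norm x < \<epsilon>"
      by (rule order_tendstoD(2)[OF _ \<epsilon>])
    with split show "\<forall>\<^sub>F \<alpha> in F. \<forall>\<^sub>F \<beta> in F. norm (cinner (V (g (v (sup \<alpha> \<beta>))) x) (V (g (v \<beta>)) x)) < \<epsilon>"
    proof eventually_elim
      case (elim \<alpha>)
      have lim: "((\<lambda>\<beta>. cinner (V (D \<alpha> (v \<beta>)) x) (V (- g (v \<alpha>)) x)) \<longlongrightarrow> cinner (Q \<alpha> x) (V (- g (v \<alpha>)) x)) F"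
        by (rule wot_tendstoD[OF limQ])
      have "norm (cinner (Q \<alpha> x) (V (- g (v \<alpha>)) x)) < \<epsilon>"
        using cauchy_schwarz[of "Q \<alpha> x" "V (- g (v \<alpha>)) x"] elim(2) by (simp add: V_norm)
      then have "\<forall>\<^sub>F \<beta> in F. norm (cinner (V (D \<alpha> (v \<beta>)) x) (V (- g (v \<alpha>)) x)) < \<epsilon>"
        by (rule order_tendstoD(2)[OF tendsto_norm[OF lim]])
      with elim(1) show ?case
      proof eventually_elim
        case (elim \<beta>)
        have "V (g (v (sup \<alpha> \<beta>))) x = V (g (v \<beta>)) (V (g (v \<alpha>)) (V (D \<alpha> (v \<beta>)) x))"
          unfolding elim(1) V_add by (rule V_commute)
        then have "cinner (V (g (v (sup \<alpha> \<beta>))) x) (V (g (v \<beta>)) x) = cinner (V (D \<alpha> (v \<beta>)) x) (V (- g (v \<alpha>)) x)"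
          by (simp only: V_cinner V_adjoint[of "g (v \<alpha>)"])
        with elim(2) show ?case by simp
      qed
    qed
  qed
  have "P (P x) = P x" for x
  proof -
    have "R (x - R x) = 0"
      by (simp add: bounded_clinearD[OF orthogonal_projectionD(1)[OF projR]] orthogonal_projectionD(2)[OF projR])
    then have "P (x - R x) = 0" by (rule on_kernel)
    then have Px: "P x = P (R x)" by (simp add: bounded_clinearD[OF linP])
    have "P (P (R x)) = P (R x)"
      by (rule on_range[symmetric]) (rule orthogonal_projectionD(2)[OF projR])
    then show ?thesis by (simp only: Px)
  qed
  then have "P \<circ> P = P" by auto
  then have "orthogonal_projection P"
    by (rule idempotent_contraction_projection[OF contP])
  then show ?case by (simp add: P_def)
qed

end


section \<open>Iterated limits in several variables\<close>

lemma idempotent_uf_filter: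
  assumes p: "ultrafilter_on FinN p" and idem: "uf_idempotent FinN (\<union>) p"
  shows "bind_filter (uf_filter FinN p) (\<lambda>\<alpha>. filtermap (sup \<alpha>) (uf_filter FinN p)) = uf_filter FinN p"
proof (rule filter_eqI)
  fix P
  have un: "s \<union> t \<in> FinN" if "s \<in> FinN" "t \<in> FinN" for s t
    using that by (auto simp: FinN_def)
  have "{s \<in> FinN. P s} \<in> p \<longleftrightarrow> {s \<in> FinN. P s} \<in> uf_prod FinN (\<union>) p p"
    using idem by (simp add: uf_idempotent_def)
  also have "\<dots> \<longleftrightarrow> {s \<in> FinN. {t \<in> FinN. P (s \<union> t)} \<in> p} \<in> p"
  proof -
    have "{t \<in> FinN. s \<union> t \<in> {s \<in> FinN. P s}} = {t \<in> FinN. P (s \<union> t)}" if "s \<in> FinN" for s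
      using un[OF that] by auto
    then have "{s \<in> FinN. {t \<in> FinN. s \<union> t \<in> {s \<in> FinN. P s}} \<in> p} = {s \<in> FinN. {t \<in> FinN. P (s \<union> t)} \<in> p}"
      by auto
    then show ?thesis unfolding uf_prod_def by auto
  qed
  finally show "eventually P (bind_filter (uf_filter FinN p) (\<lambda>\<alpha>. filtermap (sup \<alpha>) (uf_filter FinN p))) \<longleftrightarrow>
      eventually P (uf_filter FinN p)"
    by (simp add: eventually_bind_filter eventually_filtermap eventually_uf_filter[OF p])
qed

text \<open>
  The reason for excluding congested ultrafilters: an IP-set is additive on disjoint unions only, so the
  second variable has to avoid the finite set chosen first.
\<close>

lemma eventually_disjoint_if_uncongested:
  assumes p: "ultrafilter_on FinN p" and unc: "uncongested p" and "finite \<alpha>"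
  shows "\<forall>\<^sub>F \<beta> in uf_filter FinN p. \<alpha> \<inter> \<beta> = {}"
proof -
  have "\<forall>\<^sub>F \<beta> in uf_filter FinN p. i \<notin> \<beta>" for i
  proof -
    have "\<not> (\<forall>\<^sub>F \<beta> in uf_filter FinN p. i \<in> \<beta>)"
      using unc by (simp add: uncongested_def eventually_uf_filter[OF p])
    then show ?thesis
      using ultra_uf_filter[OF p] by (auto simp: ultra_def)
  qed
  then have "\<forall>\<^sub>F \<beta> in uf_filter FinN p. \<forall>i\<in>\<alpha>. i \<notin> \<beta>"
    using \<open>finite \<alpha>\<close> by (intro eventually_ball_finite) auto
  then show ?thesis by eventually_elim auto
qed

lemma ip_set_disjoint_union:
  assumes w: "ip_set w" and "\<alpha> \<in> FinN" "\<beta> \<in> FinN" "\<alpha> \<inter> \<beta> = {}"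
  shows "w (\<alpha> \<union> \<beta>) = w \<alpha> + w \<beta>"
proof -
  obtain a where a: "\<And>\<alpha>. \<alpha> \<in> FinN \<Longrightarrow> w \<alpha> = (\<Sum>i\<in>\<alpha>. a i)"
    using w by (auto simp: ip_set_def)
  have "\<alpha> \<union> \<beta> \<in> FinN" using assms by (auto simp: FinN_def)
  then show ?thesis
    using assms by (simp add: a FinN_def sum.union_disjoint)
qed

text \<open>
  The filter of the iterated quantifier over \<open>F 1\<close> (outermost) to \<open>F s\<close> (innermost), on sequences
  whose values outside \<open>{1..s}\<close> are empty, as in the iterated weak operator limit.
\<close>

primrec iterated_filter :: "nat \<Rightarrow> (nat \<Rightarrow> 'b set filter) \<Rightarrow> (nat \<Rightarrow> 'b set) filter"
  where
    "iterated_filter 0 F = principal {\<lambda>_. {}}"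
  | "iterated_filter (Suc s) F =
      bind_filter (iterated_filter s F) (\<lambda>\<alpha>. filtermap (\<lambda>\<beta>. \<alpha>(Suc s := \<beta>)) (F (Suc s)))"

lemma iterated_filter_not_bot:
  assumes "\<And>j. j \<in> {1..s} \<Longrightarrow> F j \<noteq> bot"
  shows "iterated_filter s F \<noteq> bot"
  using assms
proof (induction s)
  case (Suc s)
  then have "iterated_filter s F \<noteq> bot" "F (Suc s) \<noteq> bot"
    by auto
  then show ?case
    unfolding iterated_filter.simps by (intro bind_filter_not_bot) (simp_all add: filtermap_bot_iff)
qed (simp add: principal_eq_bot_iff)

lemma wot_tendsto_iter_wot_lim:
  assumes "\<And>j. j \<in> {1..s} \<Longrightarrow> ultrafilter_on FinN (q j)" and "\<And>\<alpha>. contraction (G \<alpha>)"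
  shows "wot_tendsto G (iter_wot_lim s q G) (iterated_filter s (\<lambda>j. uf_filter FinN (q j)))"
  using assms
proof (induction s arbitrary: G)
  case 0
  then show ?case by (auto simp: wot_tendsto_def contraction_def intro: tendsto_principal_singleton)
next
  case (Suc s)
  let ?F = "uf_filter FinN (q (Suc s))"
  define L where "L \<alpha> = wot_lim FinN (q (Suc s)) (\<lambda>\<beta>. G (\<alpha>(Suc s := \<beta>)))" for \<alpha>
  have p: "ultrafilter_on FinN (q (Suc s))" using Suc.prems by auto
  have lim: "wot_tendsto (\<lambda>\<beta>. G (\<alpha>(Suc s := \<beta>))) (L \<alpha>) ?F" for \<alpha>
  proof -
    from wot_limit_exists[OF ultra_uf_filter[OF p], of "\<lambda>\<beta>. G (\<alpha>(Suc s := \<beta>))", OF Suc.prems(2)]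
    obtain M where M: "wot_tendsto (\<lambda>\<beta>. G (\<alpha>(Suc s := \<beta>))) M ?F" ..
    then show ?thesis by (simp add: L_def wot_lim_uf_filter[OF p M])
  qed
  have "contraction (L \<alpha>)" for \<alpha>
    by (rule wot_tendsto_contraction[OF uf_filter_not_bot[OF p] lim Suc.prems(2)])
  then have "wot_tendsto L (iter_wot_lim s q L) (iterated_filter s (\<lambda>j. uf_filter FinN (q j)))"
    using Suc.prems(1) by (intro Suc.IH) auto
  moreover have "wot_tendsto G (L \<alpha>) (filtermap (\<lambda>\<beta>. \<alpha>(Suc s := \<beta>)) ?F)" for \<alpha>
    using lim by (simp add: wot_tendsto_def filterlim_filtermap)
  ultimately show ?case
    unfolding iterated_filter.simps iter_wot_lim.simps L_def[symmetric]
    by (intro wot_tendsto_bind_filter)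
qed

context unitary_rep
begin

text \<open>
  Induction on the number of variables, splitting off the innermost one. Writing the argument of \<open>g\<close>
  as \<open>x + y\<close> with \<open>y\<close> depending on the innermost variable only, the exponent is
  \<open>g x + (g (x + y) - g x)\<close>. The innermost limit thus equals \<open>V (g x) \<circ> W\<close>, where \<open>W\<close> is the limit of a polynomial in
  one vector variable without constant term and so a projection. By the chain condition, the \<open>W\<close>
  converge weakly to a projection \<open>R\<close>, hence strongly, and the whole limit is \<open>A \<circ> R\<close> with \<open>A\<close> the limit for \<open>s\<close>
  variables.
\<close>

theorem projection_iterated_limit:
  fixes g :: "(nat \<times> nat \<Rightarrow> int) \<Rightarrow> 'e" and w :: "nat \<Rightarrow> nat \<Rightarrow> nat set \<Rightarrow> nat" and n :: "nat \<Rightarrow> nat"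
  assumes q: "\<And>j. j \<in> {1..s} \<Longrightarrow> ultrafilter_on FinN (q j)"
      "\<And>j. j \<in> {1..s} \<Longrightarrow> uncongested (q j)" "\<And>j. j \<in> {1..s} \<Longrightarrow> uf_idempotent FinN (\<union>) (q j)"
    and w: "\<And>j k. j \<in> {1..s} \<Longrightarrow> k \<in> {1..n j} \<Longrightarrow> ip_set (w k j)"
    and g: "frechet d g" "g 0 = 0"
  shows "orthogonal_projection (iter_wot_lim s q
    (\<lambda>\<alpha>. V (g (\<lambda>(k, j). if (k, j) \<in> coord_vars s n then int (w k j (\<alpha> j)) else 0))))"
  using q w
proof (induction s)
  case 0
  have eq: "(\<lambda>(k, j). if (k, j) \<in> coord_vars 0 n then int (w k j {}) else 0) = 0"
    by (auto simp: coord_vars_def fun_eq_iff)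
  have "V (g (\<lambda>(k, j). if (k, j) \<in> coord_vars 0 n then int (w k j {}) else 0)) = id"
    unfolding eq g(2) by (simp add: V_zero fun_eq_iff)
  then show ?case by (simp only: iter_wot_lim.simps projection_id)
next
  case (Suc s)
  define x where "x s \<alpha> = (\<lambda>(k, j). if (k, j) \<in> coord_vars s n then int (w k j (\<alpha> j)) else 0)"
    for s and \<alpha> :: "nat \<Rightarrow> nat set"
  define y where "y \<beta> = (\<lambda>(k, j). if j = Suc s \<and> k \<in> {1..n j} then int (w k j \<beta>) else 0)" for \<beta> :: "nat set"
  define F where "F = uf_filter FinN (q (Suc s))"
  define H where "H = iterated_filter s (\<lambda>j. uf_filter FinN (q j))"
  define \<phi> where "\<phi> \<alpha> b = g (x s \<alpha> + b) - g (x s \<alpha>)" for \<alpha> b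
  define W where "W \<alpha> = lim_op F (\<lambda>\<beta>. \<phi> \<alpha> (y \<beta>))" for \<alpha>
  define A where "A = iter_wot_lim s q (\<lambda>\<alpha>. V (g (x s \<alpha>)))"
  define R where "R = iter_wot_lim s q W"
  have p: "ultrafilter_on FinN (q (Suc s))" and unc: "uncongested (q (Suc s))"
    and idem: "uf_idempotent FinN (\<union>) (q (Suc s))" using Suc.prems by auto
  have F: "ultra F" unfolding F_def by (rule ultra_uf_filter[OF p])
  have q_s: "\<And>j. j \<in> {1..s} \<Longrightarrow> ultrafilter_on FinN (q j)" using Suc.prems(1) by auto
  have H: "H \<noteq> bot"
    unfolding H_def by (intro iterated_filter_not_bot uf_filter_not_bot q_s)
  have x_Suc: "x (Suc s) (\<alpha>(Suc s := \<beta>)) = x s \<alpha> + y \<beta>" for \<alpha> \<beta>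
    by (auto simp: x_def y_def coord_vars_def fun_eq_iff)
  have \<phi>: "frechet d (\<phi> \<alpha>)" "\<phi> \<alpha> 0 = 0" for \<alpha>
    unfolding \<phi>_def using frechet_shift_pointed[OF g(1)] by auto
  have y_supp: "y \<beta> i = 0" if "i \<notin> {1..n (Suc s)} \<times> {Suc s}" for \<beta> i
    using that by (auto simp: y_def split: prod.split)
  have FinN: "\<forall>\<^sub>F \<beta> in F. \<beta> \<in> FinN"
    using p by (simp add: F_def eventually_uf_filter[OF p] ultrafilter_on_def)
  have y_add: "\<forall>\<^sub>F \<alpha> in F. \<forall>\<^sub>F \<beta> in F. y (sup \<alpha> \<beta>) = y \<alpha> + y \<beta>"
    using FinN
  proof eventually_elim
    case (elim \<alpha>)
    then have "finite \<alpha>" by (simp add: FinN_def)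
    from FinN eventually_disjoint_if_uncongested[OF p unc this, folded F_def] show ?case
    proof eventually_elim
      case (elim \<beta>)
      then show ?case
        using Suc.prems(4) \<open>\<alpha> \<in> FinN\<close>
        by (auto simp: y_def fun_eq_iff ip_set_disjoint_union)
    qed
  qed
  have one: "orthogonal_projection (lim_op F (\<lambda>\<beta>. h (y \<beta>)))" if "frechet d h" "h 0 = 0"
    for h :: "(nat \<times> nat \<Rightarrow> int) \<Rightarrow> 'e"
  proof (rule projection_one_variable[where v = y and X = "{1..n (Suc s)} \<times> {Suc s}" and d = d])
    show "bind_filter F (\<lambda>\<alpha>. filtermap (sup \<alpha>) F) = F"
      unfolding F_def by (rule idempotent_uf_filter[OF p idem])
  qed (fact F y_supp y_add that | simp)+
  have projW: "orthogonal_projection (W \<alpha>)" for \<alpha>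
    unfolding W_def by (rule one[OF \<phi>])
  have limA: "wot_tendsto (\<lambda>\<alpha>. V (g (x s \<alpha>))) A H"
    unfolding A_def H_def by (rule wot_tendsto_iter_wot_lim[OF q_s V_contraction])
  have limR: "wot_tendsto W R H"
    unfolding R_def H_def by (rule wot_tendsto_iter_wot_lim[OF q_s orthogonal_projectionD(6)[OF projW]])
  have projA: "orthogonal_projection A"
    unfolding A_def x_def by (rule Suc.IH) (use Suc.prems in auto)
  have projR: "orthogonal_projection R"
  proof (rule projection_limit_of_polynomial_family[where v = y and d = d and \<phi> = \<phi> and F = F and H = H
        and X = "{1..n (Suc s)} \<times> {Suc s}"])
    show "orthogonal_projection (lim_op F (\<lambda>\<beta>. h (y \<beta>)))" if "frechet d h" "h 0 = 0"
      for h :: "(nat \<times> nat \<Rightarrow> int) \<Rightarrow> 'e"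
      by (rule one[OF that])
    show "wot_tendsto (\<lambda>\<alpha>. lim_op F (\<lambda>\<beta>. \<phi> \<alpha> (y \<beta>))) R H"
      using limR by (simp add: W_def[abs_def])
  qed (fact F y_supp H \<phi> | simp)+
  have R_V: "R \<circ> V a = V a \<circ> R" for a
    by (rule wot_tendsto_commute[OF H limR V_adjoint]) (simp add: W_def lim_op_V[OF F])
  have AR: "A \<circ> R = R \<circ> A"
    by (rule wot_tendsto_commute[OF H limA orthogonal_projectionD(3)[OF projR]])
      (use R_V in \<open>metis comp_apply\<close>)
  have inner: "wot_lim FinN (q (Suc s)) (\<lambda>\<beta>. V (g (x (Suc s) (\<alpha>(Suc s := \<beta>))))) = V (g (x s \<alpha>)) \<circ> W \<alpha>" for \<alpha>
  proof (rule wot_lim_uf_filter[OF p])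
    have eq: "V (g (x (Suc s) (\<alpha>(Suc s := \<beta>)))) u = V (g (x s \<alpha>)) (V (\<phi> \<alpha> (y \<beta>)) u)" for \<beta> u
      unfolding V_add[symmetric] x_Suc \<phi>_def by simp
    have "bounded_clinear (V (g (x s \<alpha>)) \<circ> W \<alpha>)"
      by (intro bounded_clinear_comp V_lin orthogonal_projectionD(1) projW)
    moreover have "((\<lambda>\<beta>. cinner (V (g (x s \<alpha>)) (V (\<phi> \<alpha> (y \<beta>)) u)) z) \<longlongrightarrow> cinner (V (g (x s \<alpha>)) (W \<alpha> u)) z) F" for u z
      unfolding V_adjoint[of "g (x s \<alpha>)"] W_def by (rule wot_tendstoD[OF wot_tendsto_lim_op[OF F]])
    ultimately show "wot_tendsto (\<lambda>\<beta>. V (g (x (Suc s) (\<alpha>(Suc s := \<beta>))))) (V (g (x s \<alpha>)) \<circ> W \<alpha>)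
        (uf_filter FinN (q (Suc s)))"
      unfolding F_def[symmetric] wot_tendsto_def comp_apply eq by blast
  qed
  have "iter_wot_lim (Suc s) q (\<lambda>\<alpha>. V (g (x (Suc s) \<alpha>))) = iter_wot_lim s q (\<lambda>\<alpha>. V (g (x s \<alpha>)) \<circ> W \<alpha>)"
    unfolding iter_wot_lim.simps inner ..
  also have "\<dots> = A \<circ> R"
  proof (rule wot_tendsto_unique[OF H])
    show "wot_tendsto (\<lambda>\<alpha>. V (g (x s \<alpha>)) \<circ> W \<alpha>) (iter_wot_lim s q (\<lambda>\<alpha>. V (g (x s \<alpha>)) \<circ> W \<alpha>)) H"
      unfolding H_def
      by (rule wot_tendsto_iter_wot_lim, erule q_s)
        (intro contraction_comp V_contraction orthogonal_projectionD(6)[OF projW])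
    have "((\<lambda>\<alpha>. cinner (V (g (x s \<alpha>)) (W \<alpha> u)) z) \<longlongrightarrow> cinner (A (R u)) z) H" for u z
    proof (rule Lim_transform[OF wot_tendstoD[OF limA, of "R u" z]], rule Lim_null_comparison)
      show "((\<lambda>\<alpha>. norm (W \<alpha> u - R u) * norm z) \<longlongrightarrow> 0) H"
        by (intro tendsto_mult_left_zero projections_strong_limit[OF limR projW projR])
      have "norm (cinner (V a (W \<alpha> u)) z - cinner (V a (R u)) z) \<le> norm (W \<alpha> u - R u) * norm z" for a \<alpha>
        using cauchy_schwarz[of "V a (W \<alpha> u - R u)" z]
        by (simp only: V_norm V_diff cinner_diff_left)
          (simp only: V_diff[symmetric] V_norm)
      then show "\<forall>\<^sub>F \<alpha> in H. norm (cinner (V (g (x s \<alpha>)) (W \<alpha> u)) z - cinner (V (g (x s \<alpha>)) (R u)) z)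
          \<le> norm (W \<alpha> u - R u) * norm z" by simp
    qed
    then show "wot_tendsto (\<lambda>\<alpha>. V (g (x s \<alpha>)) \<circ> W \<alpha>) (A \<circ> R) H"
      unfolding wot_tendsto_def
      using bounded_clinear_comp[OF orthogonal_projectionD(1)[OF projA] orthogonal_projectionD(1)[OF projR]]
      by simp
  qed
  finally have "iter_wot_lim (Suc s) q (\<lambda>\<alpha>. V (g (x (Suc s) \<alpha>))) = A \<circ> R" .
  then have "orthogonal_projection (iter_wot_lim (Suc s) q (\<lambda>\<alpha>. V (g (x (Suc s) \<alpha>))))"
    using projection_comp[OF projA projR AR] by metis
  then show ?case unfolding x_def .
qed

text \<open>
  The adjoint \<open>C\<close> is what lets \<open>B\<close> pass through a weak limit.
\<close>

lemma iterated_limit_commute: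
  assumes q: "\<And>j. j \<in> {1..s} \<Longrightarrow> ultrafilter_on FinN (q j)"
    and B: "\<And>x y. cinner (B x) y = cinner x (C y)" "\<And>a x. B (V a x) = V a (B x)"
  shows "iter_wot_lim s q (\<lambda>\<alpha>. V (h \<alpha>)) \<circ> B = B \<circ> iter_wot_lim s q (\<lambda>\<alpha>. V (h \<alpha>))"
proof (rule wot_tendsto_commute)
  show "wot_tendsto (\<lambda>\<alpha>. V (h \<alpha>)) (iter_wot_lim s q (\<lambda>\<alpha>. V (h \<alpha>))) (iterated_filter s (\<lambda>j. uf_filter FinN (q j)))"
    by (rule wot_tendsto_iter_wot_lim[OF q V_contraction])
  show "iterated_filter s (\<lambda>j. uf_filter FinN (q j)) \<noteq> bot"
    by (intro iterated_filter_not_bot uf_filter_not_bot q)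
qed (simp_all add: B)

end


section \<open>Products of powers of commuting unitary operators\<close>

lemma unitary_op_bij: "unitary_op U \<Longrightarrow> bij U"
proof -
  assume U: "unitary_op U"
  then have lin: "bounded_clinear U" and "surj U" and inner: "\<And>x y. cinner (U x) (U y) = cinner x y"
    by (auto simp: unitary_op_def)
  have "inj U"
  proof (rule injI)
    fix x y assume "U x = U y"
    then have "U (x - y) = 0" by (simp add: bounded_clinearD(2)[OF lin])
    then have "cinner (x - y) (x - y) = 0" using inner[of "x - y" "x - y"] by simp
    then show "x = y" by (simp add: cinner_self)
  qed
  with \<open>surj U\<close> show ?thesis by (simp add: bij_def)
qed

lemma unitary_op_comp: "unitary_op S \<Longrightarrow> unitary_op T \<Longrightarrow> unitary_op (S \<circ> T)"
  unfolding unitary_op_def using bounded_clinear_comp[of S T] comp_surj[of T S] by (metis comp_apply)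

lemma unitary_op_id: "unitary_op id"
  using projection_id by (simp add: unitary_op_def orthogonal_projection_def)

lemma unitary_op_inv:
  assumes U: "unitary_op U"
  shows "unitary_op (inv U)"
proof -
  have lin: "bounded_clinear U" and inner: "\<And>x y. cinner (U x) (U y) = cinner x y"
    using U by (auto simp: unitary_op_def)
  have bij: "bij U" by (rule unitary_op_bij[OF U])
  then have UI: "U (inv U x) = x" and IU: "inv U (U x) = x" for x
    by (simp_all add: bij_is_surj surj_f_inv_f bij_is_inj)
  have inner': "cinner (inv U x) (inv U y) = cinner x y" for x y
    using inner[of "inv U x" "inv U y"] by (simp add: UI)
  have "contraction (inv U)"
  proof (rule contractionI)
    show "inv U (x + y) = inv U x + inv U y" for x y
      by (metis UI IU bounded_clinearD(1)[OF lin])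
    show "inv U (scaleC c x) = scaleC c (inv U x)" for c x
      by (metis UI IU bounded_clinearD(3)[OF lin])
    have "(norm (inv U x))\<^sup>2 = (norm x)\<^sup>2" for x
      by (simp only: norm_eq_Re_cinner inner')
    then show "norm (inv U x) \<le> norm x" for x by simp
  qed
  moreover have "surj (inv U)" using bij by (simp add: bij_is_inj inj_imp_surj_inv)
  ultimately show ?thesis by (simp add: unitary_op_def contraction_def inner')
qed

lemma unitary_op_powi:
  fixes U :: "'h::complex_hilbert \<Rightarrow> 'h"
  assumes "unitary_op U"
  shows "unitary_op (op_powi U k)"
proof -
  have "unitary_op (T ^^ n)" if "unitary_op T" for T :: "'h \<Rightarrow> 'h" and n
    by (induction n) (simp_all only: funpow.simps unitary_op_id unitary_op_comp that)
  then show ?thesis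
    using assms unitary_op_inv[OF assms] by (simp add: op_powi_def)
qed

lemma op_powi_Suc:
  assumes "bij U"
  shows "op_powi U (k + 1) = U \<circ> op_powi U k"
proof (cases "0 \<le> k")
  case True
  then show ?thesis by (simp add: op_powi_def nat_add_distrib)
next
  case False
  then have *: "nat (- k) = Suc (nat (- (k + 1)))" by simp
  have UI: "U \<circ> inv U = id" using assms by (simp add: bij_is_surj surj_iff[symmetric])
  have "U \<circ> op_powi U k = (U \<circ> inv U) \<circ> inv U ^^ nat (- (k + 1))"
    using False by (simp only: op_powi_def * funpow.simps if_False comp_assoc)
  also have "\<dots> = op_powi U (k + 1)"
    using False by (cases "k = -1") (simp_all add: UI op_powi_def)
  finally show ?thesis by simp
qed

lemma op_powi_pred:
  assumes "bij U"
  shows "op_powi U (k - 1) = inv U \<circ> op_powi U k"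
proof -
  have IU: "inv U \<circ> U = id" using assms by (simp add: bij_is_inj)
  have "inv U \<circ> op_powi U k = (inv U \<circ> U) \<circ> op_powi U (k - 1)"
    using op_powi_Suc[OF assms, of "k - 1"] by (simp add: comp_assoc)
  then show ?thesis by (simp add: IU)
qed

lemma op_powi_add:
  assumes "bij U"
  shows "op_powi U (k + l) = op_powi U k \<circ> op_powi U l"
proof (induction k rule: int_induct[of _ 0])
  case base
  then show ?case by (simp add: op_powi_def)
next
  case (step1 i)
  have "op_powi U (i + 1 + l) = op_powi U ((i + l) + 1)" by (simp add: algebra_simps)
  then show ?case by (simp only: op_powi_Suc[OF assms] step1 comp_assoc)
next
  case (step2 i)
  have "op_powi U (i - 1 + l) = op_powi U ((i + l) - 1)" by (simp add: algebra_simps)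
  then show ?case by (simp only: op_powi_pred[OF assms] step2 comp_assoc)
qed

lemma op_powi_commute:
  assumes U: "bij U" and comm: "U \<circ> T = T \<circ> U"
  shows "op_powi U k \<circ> T = T \<circ> op_powi U k"
proof -
  have inv: "inv U \<circ> T = T \<circ> inv U"
  proof
    fix x
    obtain y where y: "x = U y" using U by (metis bij_pointE)
    have "T (U y) = U (T y)" using comm by (metis comp_apply)
    then show "(inv U \<circ> T) x = (T \<circ> inv U) x"
      using U by (simp add: y bij_is_inj)
  qed
  show ?thesis
  proof (induction k rule: int_induct[of _ 0])
    case base
    then show ?case by (simp add: op_powi_def)
  next
    case (step1 i)
    have "U \<circ> op_powi U i \<circ> T = U \<circ> (T \<circ> op_powi U i)"
      by (simp only: step1 comp_assoc)
    also have "\<dots> = (T \<circ> U) \<circ> op_powi U i"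
      by (simp only: comp_assoc[symmetric] comm)
    finally show ?case by (simp only: op_powi_Suc[OF U] comp_assoc)
  next
    case (step2 i)
    have "inv U \<circ> op_powi U i \<circ> T = inv U \<circ> (T \<circ> op_powi U i)"
      by (simp only: step2 comp_assoc)
    also have "\<dots> = (T \<circ> inv U) \<circ> op_powi U i"
      by (simp only: comp_assoc[symmetric] inv)
    finally show ?case by (simp only: op_powi_pred[OF U] comp_assoc)
  qed
qed

lemma foldr_comp_Cons: "foldr (\<circ>) (S # Ss) id = S \<circ> foldr (\<circ>) Ss id"
  by simp

lemma foldr_comp_commute:
  assumes "\<And>i. i \<in> set is \<Longrightarrow> S i \<circ> T = T \<circ> S i"
  shows "foldr (\<circ>) (map S is) id \<circ> T = T \<circ> foldr (\<circ>) (map S is) id"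
  using assms
proof (induction "is")
  case (Cons i "is")
  let ?F = "foldr (\<circ>) (map S is) id"
  have F: "?F \<circ> T = T \<circ> ?F"
    by (rule Cons.IH) (rule Cons.prems, simp)
  have S: "S i \<circ> T = T \<circ> S i"
    by (rule Cons.prems) simp
  have "S i \<circ> ?F \<circ> T = S i \<circ> (T \<circ> ?F)"
    by (simp only: comp_assoc F)
  also have "\<dots> = T \<circ> (S i \<circ> ?F)"
    by (simp only: comp_assoc[symmetric] S)
  finally show ?case
    by (simp only: list.map foldr_comp_Cons)
qed simp

lemma foldr_comp_distrib:
  assumes "\<And>i j. i \<in> set is \<Longrightarrow> j \<in> set is \<Longrightarrow> S i \<circ> T j = T j \<circ> S i"
  shows "foldr (\<circ>) (map (\<lambda>i. S i \<circ> T i) is) id = foldr (\<circ>) (map S is) id \<circ> foldr (\<circ>) (map T is) id"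
  using assms
proof (induction "is")
  case (Cons i "is")
  let ?S = "foldr (\<circ>) (map S is) id" and ?T = "foldr (\<circ>) (map T is) id"
  have swap: "T i \<circ> ?S = ?S \<circ> T i"
    by (rule foldr_comp_commute[symmetric]) (rule Cons.prems, simp_all)
  have IH: "foldr (\<circ>) (map (\<lambda>i. S i \<circ> T i) is) id = ?S \<circ> ?T"
    by (rule Cons.IH) (rule Cons.prems, simp_all)
  have "T i \<circ> (?S \<circ> ?T) = ?S \<circ> (T i \<circ> ?T)"
    by (simp only: comp_assoc[symmetric] swap)
  then have "(S i \<circ> T i) \<circ> (?S \<circ> ?T) = (S i \<circ> ?S) \<circ> (T i \<circ> ?T)"
    by (simp only: comp_assoc)
  then show ?case
    by (simp only: list.map foldr_comp_Cons IH)
qed simp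

text \<open>
  The exponents outside \<open>{1..m}\<close> have no influence on the product, which is why a function on all
  natural numbers can serve as exponent while only \<open>m\<close> characters are involved.
\<close>

lemma unitary_rep_op_prod:
  fixes U :: "nat \<Rightarrow> 'h::complex_hilbert \<Rightarrow> 'h"
  assumes U: "\<forall>i\<in>{1..m}. unitary_op (U i)"
    and comm: "\<forall>i\<in>{1..m}. \<forall>j\<in>{1..m}. U i \<circ> U j = U j \<circ> U i"
  shows "unitary_rep (\<lambda>e :: nat \<Rightarrow> int. op_prod m (\<lambda>i. op_powi (U i) (e i)))
    ((\<lambda>i e. e i) ` {1..m})"
proof
  have set: "set [1..<m + 1] = {1..m}" by auto
  have bij: "bij (U i)" if "i \<in> {1..m}" for i using U that unitary_op_bij by blast
  have comm': "op_powi (U i) k \<circ> op_powi (U j) l = op_powi (U j) l \<circ> op_powi (U i) k"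
    if ij: "i \<in> {1..m}" "j \<in> {1..m}" for i j k l
  proof -
    have "U j \<circ> op_powi (U i) k = op_powi (U i) k \<circ> U j"
      using op_powi_commute[OF bij[OF ij(1)], of "U j" k] comm ij by auto
    from op_powi_commute[OF bij[OF ij(2)] this, of l] show ?thesis by simp
  qed
  have prod_cong: "op_prod m S = op_prod m T" if "\<And>i. i \<in> {1..m} \<Longrightarrow> S i = T i"
    for S T :: "nat \<Rightarrow> 'h \<Rightarrow> 'h"
  proof -
    have "map S [1..<m + 1] = map T [1..<m + 1]"
      using that by (intro map_cong refl) (simp only: set)
    then show ?thesis unfolding op_prod_def by (simp only:)
  qed
  have prod_id: "op_prod m (\<lambda>i. id) = (id :: 'h \<Rightarrow> 'h)"
  proof -
    have "foldr (\<circ>) (map (\<lambda>i. id) is) id = (id :: 'h \<Rightarrow> 'h)" for "is" :: "nat list"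
      by (induction "is") auto
    then show ?thesis unfolding op_prod_def .
  qed
  show "op_prod m (\<lambda>i. op_powi (U i) ((a + b) i)) x =
      op_prod m (\<lambda>i. op_powi (U i) (a i)) (op_prod m (\<lambda>i. op_powi (U i) (b i)) x)" for a b :: "nat \<Rightarrow> int" and x
  proof -
    have "op_prod m (\<lambda>i. op_powi (U i) ((a + b) i)) = op_prod m (\<lambda>i. op_powi (U i) (a i) \<circ> op_powi (U i) (b i))"
      by (rule prod_cong) (simp add: op_powi_add bij)
    also have "\<dots> = op_prod m (\<lambda>i. op_powi (U i) (a i)) \<circ> op_prod m (\<lambda>i. op_powi (U i) (b i))"
      unfolding op_prod_def by (rule foldr_comp_distrib) (simp only: set comm')
    finally show ?thesis by simp
  qed
  have trivial: "op_prod m (\<lambda>i. op_powi (U i) (a i)) x = x" if "\<And>i. i \<in> {1..m} \<Longrightarrow> a i = 0" for a :: "nat \<Rightarrow> int" and x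
  proof -
    have "op_prod m (\<lambda>i. op_powi (U i) (a i)) = op_prod m (\<lambda>i. id)"
      by (rule prod_cong) (simp add: that op_powi_def)
    then show ?thesis by (simp add: prod_id)
  qed
  show "op_prod m (\<lambda>i. op_powi (U i) ((0 :: nat \<Rightarrow> int) i)) x = x" for x
    by (rule trivial) simp
  show "op_prod m (\<lambda>i. op_powi (U i) (a i)) x = x"
    if "\<And>\<kappa>. \<kappa> \<in> (\<lambda>i e. e i) ` {1..m} \<Longrightarrow> \<kappa> a = 0" for a :: "nat \<Rightarrow> int" and x
    by (rule trivial) (use that in blast)
  show "unitary_op (op_prod m (\<lambda>i. op_powi (U i) (a i)))" for a :: "nat \<Rightarrow> int"
  proof -
    have "unitary_op (foldr (\<circ>) (map (\<lambda>i. op_powi (U i) (a i)) is) id)" if "set is \<subseteq> {1..m}" for "is"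
      using that U by (induction "is") (auto intro!: unitary_op_comp unitary_op_id unitary_op_powi)
    from this[of "[1..<m + 1]"] show ?thesis unfolding op_prod_def by (simp only: set subset_refl)
  qed
  show "finite ((\<lambda>i (e :: nat \<Rightarrow> int). e i) ` {1..m})" by simp
  show "\<kappa> (a - b) = \<kappa> a - \<kappa> b" if "\<kappa> \<in> (\<lambda>i e. e i) ` {1..m}" for \<kappa> :: "(nat \<Rightarrow> int) \<Rightarrow> int" and a b
    using that by auto
qed

lemma mpoly_eval_cong:
  assumes "\<And>v. v \<in> mpoly_vars f \<Longrightarrow> a v = b v"
  shows "mpoly_eval f a = mpoly_eval f b"
  unfolding mpoly_eval_def
proof (rule sum.cong, rule refl)
  fix \<mu> assume "\<mu> \<in> Poly_Mapping.keys f"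
  then have "a v = b v" if "v \<in> Poly_Mapping.keys \<mu>" for v
    using that assms by (auto simp: mpoly_vars_def)
  then show "Poly_Mapping.lookup f \<mu> * (\<Prod>v\<in>Poly_Mapping.keys \<mu>. a v ^ Poly_Mapping.lookup \<mu> v) =
      Poly_Mapping.lookup f \<mu> * (\<Prod>v\<in>Poly_Mapping.keys \<mu>. b v ^ Poly_Mapping.lookup \<mu> v)"
    by (simp cong: prod.cong)
qed

lemma frechet_floor_Int_poly:
  assumes f: "f \<in> Int_poly X"
  shows "\<exists>d. frechet d (\<lambda>x :: 'v \<Rightarrow> int. \<lfloor>mpoly_eval f (\<lambda>v. of_int (x v))\<rfloor>)"
proof -
  obtain d where d: "frechet d (\<lambda>x :: 'v \<Rightarrow> int. mpoly_eval f (\<lambda>v. of_int (x v)))"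
    using frechet_mpoly_eval by blast
  have "mpoly_eval f (\<lambda>v. of_int (x v)) = of_int \<lfloor>mpoly_eval f (\<lambda>v. of_int (x v))\<rfloor>" for x :: "'v \<Rightarrow> int"
    using f by (simp add: Int_poly_def of_int_floor)
  with d have "frechet d (\<lambda>x :: 'v \<Rightarrow> int. of_int \<lfloor>mpoly_eval f (\<lambda>v. of_int (x v))\<rfloor> :: rat)"
    by simp
  then have "frechet d (\<lambda>x :: 'v \<Rightarrow> int. \<lfloor>mpoly_eval f (\<lambda>v. of_int (x v))\<rfloor>)"
    by (rule frechet_of_int)
  then show ?thesis by (rule exI)
qed

text \<open>
  The arguments are extended by \<open>0\<close> outside the coordinates at hand, so that the coordinates on which
  the polynomial map depends range over a finite set.
\<close>

lemma ip_limit_operator_polynomial_form: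
  fixes U :: "nat \<Rightarrow> 'h::complex_hilbert \<Rightarrow> 'h"
  assumes data: "ip_limit_data m s n q f w"
  obtains d and g :: "(nat \<times> nat \<Rightarrow> int) \<Rightarrow> nat \<Rightarrow> int" where "frechet d g" "g 0 = 0"
    "ip_limit_operator m U s q f w = iter_wot_lim s q (\<lambda>\<alpha>. op_prod m (\<lambda>i. op_powi (U i)
      (g (\<lambda>(k, j). if (k, j) \<in> coord_vars s n then int (w k j (\<alpha> j)) else 0) i)))"
proof -
  define g :: "(nat \<times> nat \<Rightarrow> int) \<Rightarrow> nat \<Rightarrow> int"
    where "g x i = (if i \<in> {1..m} then \<lfloor>mpoly_eval (f i) (\<lambda>v. of_int (x v))\<rfloor> else 0)" for x i
  have f: "f i \<in> Int_poly (coord_vars s n)" "mpoly_eval (f i) (\<lambda>_. 0) = 0" if "i \<in> {1..m}" for i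
    using data that by (auto simp: ip_limit_data_def)
  have "\<exists>d. frechet d (\<lambda>x. g x i)" for i
  proof (cases "i \<in> {1..m}")
    case True
    then show ?thesis using frechet_floor_Int_poly[OF f(1)] by (simp add: g_def)
  next
    case False
    then show ?thesis by (intro exI[of _ 0]) (auto simp: g_def)
  qed
  then obtain D where D: "\<And>i. frechet (D i) (\<lambda>x. g x i)" by metis
  \<comment> \<open>The components may have different degrees; a map with values in tuples needs a common bound.\<close>
  define d where "d = Max (D ` {1..m})"
  have "frechet d (\<lambda>x. g x i)" for i
  proof (cases "i \<in> {1..m}")
    case True
    then have "D i \<le> d" by (simp add: d_def)
    then show ?thesis by (rule frechet_mono[OF D])
  next
    case False
    then have "(\<lambda>x. g x i) = (\<lambda>x. 0)" by (intro ext) (simp only: g_def if_False)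
    then show ?thesis by (simp only: frechet_zero)
  qed
  then have "frechet d g" by (rule frechet_components)
  moreover have "g 0 = 0"
    using f(2) by (auto simp: g_def fun_eq_iff)
  moreover have "ip_limit_operator m U s q f w = iter_wot_lim s q (\<lambda>\<alpha>. op_prod m (\<lambda>i. op_powi (U i)
      (g (\<lambda>(k, j). if (k, j) \<in> coord_vars s n then int (w k j (\<alpha> j)) else 0) i)))"
  proof -
    have "ip_exponent (f i) w \<alpha> = g (\<lambda>(k, j). if (k, j) \<in> coord_vars s n then int (w k j (\<alpha> j)) else 0) i"
      if i: "i \<in> {1..m}" for i \<alpha>
    proof -
      have "mpoly_eval (f i) (\<lambda>(k, j). of_nat (w k j (\<alpha> j))) = mpoly_eval (f i)
          (\<lambda>v. of_int ((\<lambda>(k, j). if (k, j) \<in> coord_vars s n then int (w k j (\<alpha> j)) else 0) v))"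
        by (rule mpoly_eval_cong) (use f(1)[OF i] in \<open>auto simp: Int_poly_def\<close>)
      then show ?thesis using i by (simp add: ip_exponent_def g_def)
    qed
    then have "op_prod m (\<lambda>i. op_powi (U i) (ip_exponent (f i) w \<alpha>)) = op_prod m (\<lambda>i. op_powi (U i)
      (g (\<lambda>(k, j). if (k, j) \<in> coord_vars s n then int (w k j (\<alpha> j)) else 0) i))" for \<alpha>
      unfolding op_prod_def by (intro arg_cong[where f = "\<lambda>l. foldr (\<circ>) l id"] map_cong) auto
    then show ?thesis by (simp add: ip_limit_operator_def)
  qed
  ultimately show thesis by (rule that)
qed

theorem theorem5p2:
  fixes m s :: nat
    and n :: "nat \<Rightarrow> nat"
    and U :: "nat \<Rightarrow> 'h::complex_hilbert \<Rightarrow> 'h"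
    and q :: "nat \<Rightarrow> nat set set set"
    and f :: "nat \<Rightarrow> (nat \<times> nat) rat_mpoly"
    and w :: "nat \<Rightarrow> nat \<Rightarrow> nat set \<Rightarrow> nat"
  assumes "1 \<le> m"
    and "\<forall>i\<in>{1..m}. unitary_op (U i)"
    and "\<forall>i\<in>{1..m}. \<forall>j\<in>{1..m}. U i \<circ> U j = U j \<circ> U i"
    and "ip_limit_data m s n q f w"
  shows "orthogonal_projection (ip_limit_operator m U s q f w) \<and>
    (\<forall>s' n' q' f' w'. ip_limit_data m s' n' q' f' w' \<longrightarrow>
      ip_limit_operator m U s q f w \<circ> ip_limit_operator m U s' q' f' w' =
      ip_limit_operator m U s' q' f' w' \<circ> ip_limit_operator m U s q f w)"
proof -
  define V where "V e = op_prod m (\<lambda>i. op_powi (U i) (e i))" for e :: "nat \<Rightarrow> int"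
  interpret unitary_rep V "(\<lambda>i e. e i) ` {1..m}"
    unfolding V_def[abs_def] by (rule unitary_rep_op_prod[OF assms(2,3)])
  have proj: "orthogonal_projection (ip_limit_operator m U s q f w)"
    if data: "ip_limit_data m s n q f w" for s n q f w
  proof -
    from data obtain d and g :: "(nat \<times> nat \<Rightarrow> int) \<Rightarrow> nat \<Rightarrow> int" where g: "frechet d g" "g 0 = 0"
      and eq: "ip_limit_operator m U s q f w = iter_wot_lim s q (\<lambda>\<alpha>. V
        (g (\<lambda>(k, j). if (k, j) \<in> coord_vars s n then int (w k j (\<alpha> j)) else 0)))"
      unfolding V_def by (rule ip_limit_operator_polynomial_form)
    show ?thesis
      unfolding eq by (rule projection_iterated_limit[OF _ _ _ _ g])
        (use data in \<open>auto simp: ip_limit_data_def\<close>)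
  qed
  have comm: "ip_limit_operator m U s q f w \<circ> B = B \<circ> ip_limit_operator m U s q f w"
    if data: "ip_limit_data m s n q f w" and adj: "\<And>x y. cinner (B x) y = cinner x (C y)"
      and B: "\<And>a x. B (V a x) = V a (B x)" for s n q f w B C
    unfolding ip_limit_operator_def V_def[symmetric]
    by (rule iterated_limit_commute[OF _ adj B]) (use data in \<open>auto simp: ip_limit_data_def\<close>)
  let ?P = "ip_limit_operator m U s q f w"
  have "?P \<circ> V a = V a \<circ> ?P" for a
    by (rule comm[OF assms(4) V_adjoint V_commute])
  then have P_V: "?P (V a x) = V a (?P x)" for a x
    by (metis comp_apply)
  note P = proj[OF assms(4)]
  have "?P \<circ> ip_limit_operator m U s' q' f' w' = ip_limit_operator m U s' q' f' w' \<circ> ?P"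
    if "ip_limit_data m s' n' q' f' w'" for s' n' q' f' w'
    by (rule comm[OF that orthogonal_projectionD(3)[OF P] P_V, symmetric])
  with P show ?thesis by blast
qed

end
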